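(* Let $H:\overline{\mathcal{M}}_1\to\overline{\mathcal{M}}_1$ be the hessian dynamical system on the compactified modular curve $\overline{\mathcal{M}}_1$, identified with $\mathbb{P}^1=\mathbb{C}\cup\{\infty\}$ by means of the $j$-invariant. Then, in terms of the parameter $j$, $H$ is given by $$H^*(j)= -\frac{1}{3^3}\cdot \frac{(j - 2^8\cdot 3^3)^3}{j^2}.$$
   Context: Everything is over $\mathbb{C}$. For a homogeneous polynomial $f\in\mathbb{C}[x,y,z]$, $\mathrm{Hess}(f)$ is the determinant of the $3\times 3$ matrix of second partial derivatives of $f$. For a plane projective curve $C=Z(f)\subset\mathbb{P}^2$, $\mathrm{Hess}(C)$ is the curve defined by $\mathrm{Hess}(f)$; if $C$ is a cubic, $\mathrm{Hess}(f)$ again has degree $3$. The $j$-invariant is normalized so that the elliptic curve with affine equation $y^2=4x^3-g_2x-g_3$ (with $g_2^3-27g_3^2\neq 0$) has $j=1728\, g_2^3/(g_2^3-27g_3^2)$. The coarse moduli space $\mathcal{M}_1$ of elliptic curves is the quotient of the space of smooth plane cubics by the group of projectivities of $\mathbb{P}^2$; it is identified with the affine line with coordinate $j$, and $\overline{\mathcal{M}}_1\simeq\mathbb{P}^1$ is its compactification by one point $j=\infty$. The hessian dynamical system is the algebraic map $H:\overline{\mathcal{M}}_1\to\overline{\mathcal{M}}_1$ which associates to each elliptic curve the isomorphism type of the hessian of a smooth plane cubic corresponding to it. That is, $H$ is the unique algebraic morphism $\mathbb{P}^1\to\mathbb{P}^1$ such that $H(j(C))=j(\mathrm{Hess}(C))$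 for every smooth plane cubic $C$ whose hessian curve $\mathrm{Hess}(C)$ is smooth. $H^*(j)$ denotes the pull-back by $H$ of the coordinate function $j$, i.e. the rational function $j\circ H$ expressed in the variable $j$. *)

theory Defs
  imports
    "HOL-Analysis.Determinants"
    "HOL-Library.Poly_Mapping"
    "HOL-Computational_Algebra.Computational_Algebra"
begin

section \<open>Ternary polynomials over the complex numbers\<close>

text \<open>
  An element of \<open>\<complex>[x, y, z]\<close> is a finitely supported map from exponent vectors to
  coefficients; the ring structure is the convolution product of \<^theory>\<open>HOL-Library.Poly_Mapping\<close>.
  The variables are indexed by the three-element type, and \<open>x\<close>, \<open>y\<close>, \<open>z\<close> correspond to the
  indices 1, 2, 3 (in this type 3 is the same element as 0).
\<close>

type_synonym tpoly = "(3 \<Rightarrow>\<^sub>0 nat) \<Rightarrow>\<^sub>0 complex"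

definition Const :: "complex \<Rightarrow> tpoly" where
  "Const c = Poly_Mapping.single 0 c"

definition Var :: "3 \<Rightarrow> tpoly" where
  "Var i = Poly_Mapping.single (Poly_Mapping.single i 1) 1"

definition tpoly_eval :: "tpoly \<Rightarrow> complex ^ 3 \<Rightarrow> complex" where
  "tpoly_eval f v =
     (\<Sum>m \<in> Poly_Mapping.keys f.
        Poly_Mapping.lookup f m * (\<Prod>i\<in>UNIV. (v $ i) ^ Poly_Mapping.lookup m i))"

definition homogeneous :: "nat \<Rightarrow> tpoly \<Rightarrow> bool" where
  "homogeneous d f \<longleftrightarrow>
     (\<forall>m \<in> Poly_Mapping.keys f. (\<Sum>i\<in>UNIV. Poly_Mapping.lookup m i) = d)"

text \<open>
  The truncated difference of exponents is harmless: if the variable does not occur in the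
  monomial, the coefficient is 0.
\<close>

definition partial :: "3 \<Rightarrow> tpoly \<Rightarrow> tpoly" where
  "partial i f =
     (\<Sum>m \<in> Poly_Mapping.keys f.
        Poly_Mapping.single (m - Poly_Mapping.single i 1)
          (of_nat (Poly_Mapping.lookup m i) * Poly_Mapping.lookup f m))"

definition Hess :: "tpoly \<Rightarrow> tpoly" where
  "Hess f = det (\<chi> i j. partial i (partial j f))"


section \<open>Plane cubics and the j-invariant\<close>

text \<open>
  A plane curve \<open>Z(f)\<close> is represented by a form \<open>f\<close> defining it. The zero form is not smooth,
  so a smooth cubic has degree exactly 3.
\<close>

definition smooth_cubic :: "tpoly \<Rightarrow> bool" where
  "smooth_cubic f \<longleftrightarrow> homogeneous 3 f \<and>
     (\<nexists>v. v \<noteq> 0 \<and> tpoly_eval f v = 0 \<and> (\<forall>i. tpoly_eval (partial i f) v = 0))"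

text \<open>
  Some projectivity of the plane carries one curve to the other. Since \<open>\<complex>\<close> is infinite, the
  equality of the polynomial functions is the equality of the polynomials.
\<close>

definition projectively_equivalent :: "tpoly \<Rightarrow> tpoly \<Rightarrow> bool" where
  "projectively_equivalent f g \<longleftrightarrow>
     (\<exists>(A :: complex ^ 3 ^ 3) c. invertible A \<and> c \<noteq> 0 \<and>
        (\<forall>v. tpoly_eval g v = c * tpoly_eval f (A *v v)))"

text \<open>The projective closure of the affine curve \<open>y\<^sup>2 = 4x\<^sup>3 - g\<^sub>2x - g\<^sub>3\<close>.\<close>

definition weierstrass :: "complex \<Rightarrow> complex \<Rightarrow> tpoly" where
  "weierstrass g2 g3 =
     (Var 2)^2 * Var 3
       - (4 * (Var 1)^3 - Const g2 * Var 1 * (Var 3)^2 - Const g3 * (Var 3)^3)"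

definition j_invariant :: "tpoly \<Rightarrow> complex" where
  "j_invariant f =
     (THE j. \<exists>g2 g3. g2^3 - 27 * g3^2 \<noteq> 0 \<and>
        projectively_equivalent f (weierstrass g2 g3) \<and>
        j = 1728 * g2^3 / (g2^3 - 27 * g3^2))"


section \<open>Morphisms of the projective line\<close>

text \<open>\<open>Some z\<close> is the finite point \<open>z = [z : 1]\<close> and \<open>None\<close> is \<open>\<infinity> = [1 : 0]\<close>.\<close>

type_synonym P1 = "complex option"

text \<open>
  With \<open>n\<close> the larger of the two degrees, this is
  \<open>[s : t] \<mapsto> [t\<^sup>n p(s/t) : t\<^sup>n q(s/t)]\<close>, in homogeneous coordinates. For coprime \<open>p\<close> and \<open>q\<close> the
  two forms of degree \<open>n\<close> have no common zero, and all morphisms from the projective line to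
  itself, including the constant ones, arise in this way.
\<close>

definition P1_map :: "complex poly \<Rightarrow> complex poly \<Rightarrow> P1 \<Rightarrow> P1" where
  "P1_map p q w =
     (let n = max (degree p) (degree q);
          a = (case w of Some z \<Rightarrow> poly p z | None \<Rightarrow> coeff p n);
          b = (case w of Some z \<Rightarrow> poly q z | None \<Rightarrow> coeff q n)
      in if b = 0 then None else Some (a / b))"

definition P1_morphism :: "(P1 \<Rightarrow> P1) \<Rightarrow> bool" where
  "P1_morphism H \<longleftrightarrow> (\<exists>p q. coprime p q \<and> H = P1_map p q)"

text \<open>The coordinate function, as an element of the function field of the projective line.\<close>

definition j_coord :: "complex poly fract" where
  "j_coord = Fract [:0, 1:] 1"

text \<open>
  The rational function whose value at almost every \<open>z\<close> is the coordinate of \<open>H(z)\<close>. It exists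
  for every morphism that is not constantly \<open>\<infinity>\<close>.
\<close>

definition pullback_coord :: "(P1 \<Rightarrow> P1) \<Rightarrow> complex poly fract" where
  "pullback_coord H =
     (THE r. \<exists>p q. q \<noteq> 0 \<and> r = Fract p q \<and>
        (\<forall>z. poly q z \<noteq> 0 \<longrightarrow> H (Some z) = Some (poly p z / poly q z)))"


section \<open>The hessian dynamical system\<close>

definition hessian_dynamics :: "P1 \<Rightarrow> P1" where
  "hessian_dynamics =
     (THE H. P1_morphism H \<and>
        (\<forall>f. smooth_cubic f \<and> smooth_cubic (Hess f) \<longrightarrow>
           H (Some (j_invariant f)) = Some (j_invariant (Hess f))))"

end

theory Submission
  imports Defs "HOL-Computational_Algebra.Field_as_Ring"
begin

text \<open>
  The map is computed on Weierstrass cubics, where both a cubic and its hessian can be put into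
  Weierstrass form explicitly. What takes work is to show that this computation determines
  \<^const>\<open>hessian_dynamics\<close>: every smooth cubic has to be equivalent to a Weierstrass cubic, and the
  j-invariant must not depend on the Weierstrass cubic that is chosen.

  \<^emph>\<open>Covariance.\<close> If \<open>g(v) = c f(A v)\<close>, then \<open>Hess g (v) = c\<^sup>3 (det A)\<^sup>2 Hess f (A v)\<close> (lemma
  \<open>Hess_covariant\<close>). The formal partial derivatives evaluate to directional derivatives, so that
  this is the chain rule together with the multiplicativity of the determinant. Hence the hessian
  of a curve is well defined up to projectivities.

  \<^emph>\<open>Existence of a Weierstrass form.\<close> A smooth cubic has a flex, that is, a zero of \<open>f\<close> and
  \<open>Hess f\<close> (lemma \<open>flex_exists\<close>). The weak form of the theorem of Bezout behind this comes from a
  resultant: eliminating one variable leaves a form of degree 9 in the other two, and such a form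
  has a nontrivial zero. If the flex is moved to \<open>[0 : 1 : 0]\<close> and its tangent to \<open>z = 0\<close>, then the
  coefficients of \<open>y\<^sup>3\<close>, \<open>x y\<^sup>2\<close> and \<open>x\<^sup>2 y\<close> vanish, and completing the square in \<open>y\<close> and the cube
  in \<open>x\<close> leads to \<open>y\<^sup>2 z = 4 x\<^sup>3 - g\<^sub>2 x z\<^sup>2 - g\<^sub>3 z\<^sup>3\<close> (lemma \<open>smooth_cubic_weierstrass_form\<close>).

  \<^emph>\<open>Uniqueness of j.\<close> For a Weierstrass cubic \<open>f\<close>, the hessian of a member \<open>\<lambda> f + \<mu> Hess f\<close> of the
  pencil spanned by \<open>f\<close> and \<open>Hess f\<close> lies in this pencil again, and the coefficients that
  describe it are polynomials in \<open>g\<^sub>2\<close> and \<open>g\<^sub>3\<close> (lemma \<open>weierstrass_Hess_pencil\<close>). By covariance an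
  equivalence between two Weierstrass cubics respects these pencils, and a comparison of
  coefficients shows that it multiplies \<open>g\<^sub>2\<close> by \<open>k\<^sup>4\<close> and \<open>g\<^sub>3\<close> by \<open>k\<^sup>6\<close> for some \<open>k \<noteq> 0\<close> (lemma
  \<open>equivalent_weierstrass_scaling\<close>). This replaces the classical invariants of degree 4 and 6
  of a ternary cubic.

  \<^emph>\<open>The formula.\<close> A flex of a cubic is also a flex of its hessian. For the Weierstrass cubic with
  coefficients \<open>g\<^sub>2\<close> and \<open>g\<^sub>3\<close> the flex \<open>[0 : 1 : 0]\<close> of the hessian has the tangent \<open>x = 0\<close>, so a
  linear substitution that exchanges \<open>x\<close> and \<open>z\<close> yields the Weierstrass form of the hessian (lemma
  \<open>weierstrass_Hess_equivalent\<close>), hence its j-invariant as a rational function of \<open>j\<close> (lemma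
  \<open>j_invariant_Hess\<close>). Every \<open>j \<noteq> 0\<close> is attained by a smooth cubic with smooth hessian, and a
  morphism of the projective line is determined by its values outside of a finite set.
\<close>

unbundle no Formal_Power_Series.fps_syntax

section \<open>Polynomials as functions\<close>

abbreviation mono_val :: "(3 \<Rightarrow>\<^sub>0 nat) \<Rightarrow> complex ^ 3 \<Rightarrow> complex" where
  "mono_val m v \<equiv> (\<Prod>i\<in>UNIV. (v $ i) ^ Poly_Mapping.lookup m i)"

lemma tpoly_eval_superset:
  assumes "finite S" "Poly_Mapping.keys f \<subseteq> S"
  shows "tpoly_eval f v = (\<Sum>m\<in>S. Poly_Mapping.lookup f m * mono_val m v)"
  unfolding tpoly_eval_def
  by (rule sum.mono_neutral_left) (use assms in \<open>auto simp: in_keys_iff\<close>)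

lemma tpoly_eval_zero [simp]: "tpoly_eval 0 v = 0"
  by (simp add: tpoly_eval_def)

lemma tpoly_eval_single [simp]: "tpoly_eval (Poly_Mapping.single m c) v = c * mono_val m v"
  by (subst tpoly_eval_superset[of "{m}"]) auto

lemma tpoly_eval_add [simp]: "tpoly_eval (f + g) v = tpoly_eval f v + tpoly_eval g v"
proof -
  let ?S = "Poly_Mapping.keys f \<union> Poly_Mapping.keys g"
  have "Poly_Mapping.keys (f + g) \<subseteq> ?S"
    by (rule Poly_Mapping.keys_add)
  then show ?thesis
    by (simp add: tpoly_eval_superset[of ?S] lookup_add distrib_right sum.distrib)
qed

lemma tpoly_eval_sum [simp]: "tpoly_eval (\<Sum>i\<in>I. f i) v = (\<Sum>i\<in>I. tpoly_eval (f i) v)"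
  by (induction I rule: infinite_finite_induct) auto

lemma tpoly_eval_uminus [simp]: "tpoly_eval (- f) v = - tpoly_eval f v"
  using tpoly_eval_add[of f "- f" v] by (simp add: add_eq_0_iff2)

lemma tpoly_eval_diff [simp]: "tpoly_eval (f - g) v = tpoly_eval f v - tpoly_eval g v"
  using tpoly_eval_add[of f "- g" v] by simp

lemma tpoly_sum_monomials:
  "f = (\<Sum>m\<in>Poly_Mapping.keys f. Poly_Mapping.single m (Poly_Mapping.lookup f m))" for f :: tpoly
  by (rule poly_mapping_eqI)
    (auto simp: lookup_sum lookup_single when_def in_keys_iff sum.delta)

lemma tpoly_eval_mult [simp]: "tpoly_eval (f * g) v = tpoly_eval f v * tpoly_eval g v"
proof -
  have "f * g = (\<Sum>m\<in>Poly_Mapping.keys f. \<Sum>n\<in>Poly_Mapping.keys g.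
      Poly_Mapping.single (m + n) (Poly_Mapping.lookup f m * Poly_Mapping.lookup g n))"
    by (subst tpoly_sum_monomials[of f], subst tpoly_sum_monomials[of g])
      (simp add: sum_distrib_left sum_distrib_right mult_single, rule sum.swap)
  then show ?thesis
    by (simp add: tpoly_eval_def[of f] tpoly_eval_def[of g] sum_product lookup_add power_add
        prod.distrib mult_ac)
qed

lemma tpoly_eval_one [simp]: "tpoly_eval 1 v = 1"
  unfolding single_one[symmetric] by (simp del: single_one)

lemma tpoly_eval_Const [simp]: "tpoly_eval (Const c) v = c"
  by (simp add: Const_def)

lemma tpoly_eval_numeral [simp]: "tpoly_eval (numeral n) v = numeral n"
proof -
  have "tpoly_eval (of_nat k) v = of_nat k" for k
    by (induction k) auto
  from this[of "numeral n"] show ?thesis by simp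
qed

lemma tpoly_eval_power [simp]: "tpoly_eval (f ^ n) v = tpoly_eval f v ^ n"
  by (induction n) auto

lemma tpoly_eval_prod [simp]: "tpoly_eval (\<Prod>i\<in>I. f i) v = (\<Prod>i\<in>I. tpoly_eval (f i) v)"
  by (induction I rule: infinite_finite_induct) auto

lemma tpoly_eval_Var [simp]: "tpoly_eval (Var i) v = v $ i"
proof -
  have "mono_val (Poly_Mapping.single i 1) v = (\<Prod>k\<in>UNIV. if k = i then v $ k else 1)"
    by (rule prod.cong) (auto simp: lookup_single when_def)
  then show ?thesis
    by (simp add: Var_def prod.delta)
qed

lemma tpoly_eval_Hess:
  "tpoly_eval (Hess f) v = det (\<chi> i j. tpoly_eval (partial i (partial j f)) v)"
  by (simp add: Hess_def det_3)

section \<open>Homogeneous polynomials\<close>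

abbreviation mono_deg :: "(3 \<Rightarrow>\<^sub>0 nat) \<Rightarrow> nat" where
  "mono_deg m \<equiv> (\<Sum>i\<in>UNIV. Poly_Mapping.lookup m i)"

lemma homogeneous_zero: "homogeneous d 0"
  by (simp add: homogeneous_def)

lemma homogeneous_single: "mono_deg m = d \<Longrightarrow> homogeneous d (Poly_Mapping.single m c)"
  by (simp add: homogeneous_def)

lemma homogeneous_add:
  "homogeneous d f \<Longrightarrow> homogeneous d g \<Longrightarrow> homogeneous d (f + g)"
  using Poly_Mapping.keys_add[of f g] unfolding homogeneous_def by blast

lemma homogeneous_uminus: "homogeneous d f \<Longrightarrow> homogeneous d (- f)"
  by (simp add: homogeneous_def)

lemma homogeneous_diff:
  "homogeneous d f \<Longrightarrow> homogeneous d g \<Longrightarrow> homogeneous d (f - g)"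
  using homogeneous_add[of d f "- g"] homogeneous_uminus[of d g] by simp

lemma homogeneous_sum:
  "(\<And>i. i \<in> I \<Longrightarrow> homogeneous d (f i)) \<Longrightarrow> homogeneous d (\<Sum>i\<in>I. f i)"
  by (induction I rule: infinite_finite_induct)
    (auto intro: homogeneous_add homogeneous_zero)

lemma homogeneous_mult:
  assumes "homogeneous d f" "homogeneous e g"
  shows "homogeneous (d + e) (f * g)"
  unfolding homogeneous_def
proof
  fix m assume "m \<in> Poly_Mapping.keys (f * g)"
  then obtain a b where "m = a + b" "a \<in> Poly_Mapping.keys f" "b \<in> Poly_Mapping.keys g"
    using keys_mult[of f g] by auto
  with assms show "mono_deg m = d + e"
    by (simp add: homogeneous_def lookup_add sum.distrib)
qed

lemma homogeneous_Const: "homogeneous 0 (Const c)"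
  by (auto simp: Const_def intro: homogeneous_single)

lemma homogeneous_Var: "homogeneous 1 (Var i)"
  unfolding Var_def by (rule homogeneous_single) (simp add: lookup_single when_def)

lemma homogeneous_one: "homogeneous 0 1"
  using homogeneous_Const[of 1] by (simp add: Const_def)

lemma homogeneous_power:
  assumes "homogeneous d f" shows "homogeneous (n * d) (f ^ n)"
  by (induction n) (auto intro: homogeneous_one homogeneous_mult[OF assms])

lemma homogeneous_prod:
  assumes "\<And>i. i \<in> I \<Longrightarrow> homogeneous (d i) (f i)"
  shows "homogeneous (\<Sum>i\<in>I. d i) (\<Prod>i\<in>I. f i)"
  using assms by (induction I rule: infinite_finite_induct)
    (auto intro: homogeneous_one homogeneous_mult)

lemma homogeneous_partial:
  assumes "homogeneous d f"
  shows "homogeneous (d - 1) (partial i f)"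
  unfolding partial_def
proof (rule homogeneous_sum)
  fix m assume m: "m \<in> Poly_Mapping.keys f"
  show "homogeneous (d - 1) (Poly_Mapping.single (m - Poly_Mapping.single i 1)
          (of_nat (Poly_Mapping.lookup m i) * Poly_Mapping.lookup f m))"
  proof (cases "Poly_Mapping.lookup m i = 0")
    case True
    then show ?thesis by (simp add: homogeneous_zero)
  next
    case False
    have "mono_deg m = mono_deg ((m - Poly_Mapping.single i 1) + Poly_Mapping.single i 1)"
      using False
      by (intro sum.cong) (auto simp: lookup_add lookup_minus lookup_single when_def)
    also have "\<dots> = mono_deg (m - Poly_Mapping.single i 1) + 1"
      by (simp add: lookup_add sum.distrib lookup_single when_def)
    finally show ?thesis
      using assms m by (intro homogeneous_single) (simp add: homogeneous_def)
  qed
qed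

lemma homogeneous_Hess:
  assumes "homogeneous 3 f"
  shows "homogeneous 3 (Hess f)"
proof -
  have 1: "homogeneous 1 (partial i (partial j f))" for i j
    using homogeneous_partial[OF homogeneous_partial[OF assms]] by simp
  have "homogeneous 3 (partial a (partial b f) * partial c (partial d f) * partial e (partial g f))"
    for a b c d e g
    using homogeneous_mult[OF homogeneous_mult[OF 1 1] 1] by (simp add: numeral_3_eq_3)
  then show ?thesis
    unfolding Hess_def det_3 vec_lambda_beta
    by (intro homogeneous_add homogeneous_diff)
qed

lemma homogeneous_weierstrass: "homogeneous 3 (weierstrass g2 g3)"
proof -
  have 1: "homogeneous 3 (Var i ^ 3)" for i
    using homogeneous_power[OF homogeneous_Var, of 3] by simp
  have 2: "homogeneous 2 (Var i ^ 2)" for i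
    using homogeneous_power[OF homogeneous_Var, of 2] by simp
  have 3: "homogeneous 3 (Var 2 ^ 2 * Var 3)"
    using homogeneous_mult[OF 2 homogeneous_Var] by simp
  have 4: "homogeneous 3 (Const g * Var i ^ 3)" for g i
    using homogeneous_mult[OF homogeneous_Const 1] by simp
  have 5: "homogeneous 3 (Const g2 * Var 1 * Var 3 ^ 2)"
    using homogeneous_mult[OF homogeneous_mult[OF homogeneous_Const homogeneous_Var] 2]
    by (simp add: numeral_3_eq_3)
  have "(4 :: tpoly) = Const 4"
    by (simp add: Const_def)
  with 4[of 4 1] have "homogeneous 3 (4 * Var 1 ^ 3)"
    by simp
  then show ?thesis
    unfolding weierstrass_def by (intro homogeneous_diff 3 4 5)
qed

lemma linear_substitution:
  assumes "homogeneous d f"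
  obtains g where "homogeneous d g" "\<And>v. tpoly_eval g v = tpoly_eval f (A *v v)"
proof
  define L where "L i = (\<Sum>j\<in>UNIV. Const (A $ i $ j) * Var j)" for i
  define g where "g = (\<Sum>m\<in>Poly_Mapping.keys f. Const (Poly_Mapping.lookup f m) *
      (\<Prod>i\<in>UNIV. L i ^ Poly_Mapping.lookup m i))"
  have L: "homogeneous 1 (L i)" for i
    using homogeneous_mult[OF homogeneous_Const homogeneous_Var]
    by (auto simp: L_def intro: homogeneous_sum)
  show "homogeneous d g"
    unfolding g_def
  proof (rule homogeneous_sum)
    fix m assume "m \<in> Poly_Mapping.keys f"
    then have "mono_deg m = d" using assms by (simp add: homogeneous_def)
    moreover have "homogeneous (0 + (\<Sum>i\<in>UNIV. Poly_Mapping.lookup m i * 1))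
       (Const (Poly_Mapping.lookup f m) * (\<Prod>i\<in>UNIV. L i ^ Poly_Mapping.lookup m i))"
      by (intro homogeneous_mult homogeneous_Const homogeneous_prod homogeneous_power L)
    ultimately show "homogeneous d
       (Const (Poly_Mapping.lookup f m) * (\<Prod>i\<in>UNIV. L i ^ Poly_Mapping.lookup m i))"
      by simp
  qed
  show "tpoly_eval g v = tpoly_eval f (A *v v)" for v
    by (simp add: g_def L_def tpoly_eval_def[of f] matrix_vector_mult_def)
qed

lemma mono_val_3:
  "mono_val m v = v $ 1 ^ Poly_Mapping.lookup m 1 * v $ 2 ^ Poly_Mapping.lookup m 2
     * v $ 3 ^ Poly_Mapping.lookup m 3"
  unfolding UNIV_3 by (simp add: mult.assoc)

section \<open>Formal and analytic derivatives\<close>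

lemma tpoly_eval_partial:
  "tpoly_eval (partial i f) v = (\<Sum>m\<in>Poly_Mapping.keys f. Poly_Mapping.lookup f m *
     (of_nat (Poly_Mapping.lookup m i) * mono_val (m - Poly_Mapping.single i 1) v))"
  by (simp add: partial_def mult_ac)

lemma mono_val_directional_derivative:
  "((\<lambda>t. mono_val m (v + t *s w)) has_field_derivative
     (\<Sum>i\<in>UNIV. w $ i * (of_nat (Poly_Mapping.lookup m i)
        * mono_val (m - Poly_Mapping.single i 1) v))) (at 0)"
  unfolding mono_val_3 sum_3
  by (auto intro!: derivative_eq_intros simp: lookup_minus lookup_single when_def algebra_simps)

lemma directional_derivative:
  "((\<lambda>t. tpoly_eval f (v + t *s w)) has_field_derivative
     (\<Sum>i\<in>UNIV. w $ i * tpoly_eval (partial i f) v)) (at 0)"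
proof -
  have "((\<lambda>t. tpoly_eval f (v + t *s w)) has_field_derivative
     (\<Sum>m\<in>Poly_Mapping.keys f. Poly_Mapping.lookup f m *
       (\<Sum>i\<in>UNIV. w $ i * (of_nat (Poly_Mapping.lookup m i)
        * mono_val (m - Poly_Mapping.single i 1) v)))) (at 0)"
    unfolding tpoly_eval_def
    by (intro DERIV_sum DERIV_cmult mono_val_directional_derivative)
  also have "(\<Sum>m\<in>Poly_Mapping.keys f. Poly_Mapping.lookup f m *
       (\<Sum>i\<in>UNIV. w $ i * (of_nat (Poly_Mapping.lookup m i)
        * mono_val (m - Poly_Mapping.single i 1) v)))
      = (\<Sum>i\<in>UNIV. w $ i * tpoly_eval (partial i f) v)"
    unfolding tpoly_eval_partial sum_distrib_left
    by (subst sum.swap) (simp add: mult_ac)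
  finally show ?thesis .
qed

text \<open>
  Together with \<open>directional_derivative\<close> this means that the values of a partial derivative depend
  only on the polynomial function. Hence partial derivatives may be computed from any formula for
  the values of \<open>f\<close>.
\<close>

lemma tpoly_eval_partial_eqI:
  assumes "((\<lambda>t. tpoly_eval f (v + t *s axis i 1)) has_field_derivative D) (at 0)"
  shows "tpoly_eval (partial i f) v = D"
proof -
  have "(\<Sum>k\<in>UNIV. axis i 1 $ k * tpoly_eval (partial k f) v) = tpoly_eval (partial i f) v"
    by (simp add: axis_def if_distrib[of "\<lambda>x. x * _"] sum.delta cong: if_cong)
  then show ?thesis
    using DERIV_unique[OF directional_derivative assms] by simp
qed

lemma matrix_vector_mult_shift:
  "A *v (v + t *s axis i 1) = A *v v + t *s column i A" for A :: "complex ^ 3 ^ 3"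
  by (simp add: vec_eq_iff matrix_vector_mult_def column_def axis_def distrib_left
      sum.distrib if_distrib[of "\<lambda>x. _ * x"] sum.delta mult.commute cong: if_cong)

text \<open>
  The first derivatives of a composition with \<open>A\<close> are sums of this kind, so that the lemma can be
  applied twice to obtain the second derivatives.
\<close>

lemma partial_of_sum_composition:
  fixes A :: "complex ^ 3 ^ 3"
  assumes "\<And>v. tpoly_eval g v = (\<Sum>k\<in>I. c k * tpoly_eval (f k) (A *v v))"
  shows "tpoly_eval (partial i g) v =
    (\<Sum>k\<in>I. c k * (\<Sum>l\<in>UNIV. A $ l $ i * tpoly_eval (partial l (f k)) (A *v v)))"
proof (rule tpoly_eval_partial_eqI)
  have "((\<lambda>t. \<Sum>k\<in>I. c k * tpoly_eval (f k) (A *v v + t *s column i A)) has_field_derivative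
    (\<Sum>k\<in>I. c k * (\<Sum>l\<in>UNIV. column i A $ l * tpoly_eval (partial l (f k)) (A *v v)))) (at 0)"
    by (intro DERIV_sum DERIV_cmult directional_derivative)
  then show "((\<lambda>t. tpoly_eval g (v + t *s axis i 1)) has_field_derivative
    (\<Sum>k\<in>I. c k * (\<Sum>l\<in>UNIV. A $ l $ i * tpoly_eval (partial l (f k)) (A *v v)))) (at 0)"
    by (simp add: assms matrix_vector_mult_shift) (simp add: column_def)
qed

lemma partial_of_composition:
  assumes "\<And>v. tpoly_eval g v = c * tpoly_eval f (A *v v)"
  shows "tpoly_eval (partial i g) v = c * (\<Sum>k\<in>UNIV. A $ k $ i * tpoly_eval (partial k f) (A *v v))"
  using partial_of_sum_composition[where g = g and I = "{()}" and c = "\<lambda>_. c"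
    and f = "\<lambda>_. f" and A = A and i = i and v = v] assms
  by simp

lemma det_scaled_3: "det (\<chi> i j. c * M $ i $ j) = c ^ 3 * det (M :: complex ^ 3 ^ 3)"
  unfolding det_3 vec_lambda_beta by (simp add: algebra_simps power3_eq_cube)

text \<open>
  The matrix of second derivatives of \<open>g\<close> is \<open>c A\<^sup>T M A\<close>, where \<open>M\<close> is the one of \<open>f\<close> at \<open>A v\<close>.
\<close>

lemma Hess_covariant:
  assumes "\<And>v. tpoly_eval g v = c * tpoly_eval f (A *v v)"
  shows "tpoly_eval (Hess g) v = c ^ 3 * det A ^ 2 * tpoly_eval (Hess f) (A *v v)"
proof -
  let ?M = "\<chi> i j. tpoly_eval (partial i (partial j f)) (A *v v)"
  have "tpoly_eval (partial i (partial j g)) v =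
     c * (\<Sum>k\<in>UNIV. \<Sum>l\<in>UNIV. A $ k $ j * A $ l $ i * tpoly_eval (partial l (partial k f)) (A *v v))"
    for i j
    using partial_of_sum_composition[where g = "partial j g" and I = UNIV
        and c = "\<lambda>k. c * A $ k $ j" and f = "\<lambda>k. partial k f" and A = A and i = i and v = v]
      partial_of_composition[OF assms, of j]
    by (simp add: sum_distrib_left mult_ac)
  then have "(\<chi> i j. tpoly_eval (partial i (partial j g)) v) = (\<chi> i j. c * (transpose A ** ?M ** A) $ i $ j)"
    by (simp add: vec_eq_iff matrix_matrix_mult_def transpose_def sum_distrib_right
        sum_distrib_left mult_ac)
  also have "det \<dots> = c ^ 3 * det (transpose A ** ?M ** A)"
    by (rule det_scaled_3)
  also have "\<dots> = c ^ 3 * det A ^ 2 * det ?M"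
    by (simp add: det_mul power2_eq_square)
  finally show ?thesis
    by (simp add: tpoly_eval_Hess)
qed

text \<open>
  The coefficient \<open>c\<close> with index \<open>ijk\<close> belongs to the monomial \<open>x\<^sup>i y\<^sup>j z\<^sup>k\<close>.
\<close>

abbreviation cubic_form where
  "cubic_form c300 c030 c003 c210 c201 c120 c021 c102 c012 c111 v \<equiv>
      c300 * (v$1)^3 + c030 * (v$2)^3 + c003 * (v$3)^3
      + c210 * (v$1)^2 * v$2 + c201 * (v$1)^2 * v$3 + c120 * v$1 * (v$2)^2
      + c021 * (v$2)^2 * v$3 + c102 * v$1 * (v$3)^2 + c012 * v$2 * (v$3)^2
      + c111 * v$1 * v$2 * (v :: complex ^ 3)$3"

lemma axis_shift:
  fixes v :: "complex ^ 3"
  shows "(v + t *s axis 1 1) $ 1 = v $ 1 + t" "(v + t *s axis 1 1) $ 2 = v $ 2"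
    "(v + t *s axis 1 1) $ 3 = v $ 3" "(v + t *s axis 2 1) $ 1 = v $ 1"
    "(v + t *s axis 2 1) $ 2 = v $ 2 + t" "(v + t *s axis 2 1) $ 3 = v $ 3"
    "(v + t *s axis 3 1) $ 1 = v $ 1" "(v + t *s axis 3 1) $ 2 = v $ 2"
    "(v + t *s axis 3 1) $ 3 = v $ 3 + t"
  by (simp_all add: axis_def)

text \<open>
  The second derivatives of a cubic are linear forms, so that its hessian can be read off from the
  ten coefficients. All concrete derivatives and hessians of cubics below are instances of this.
\<close>

lemma explicit_cubic:
  assumes f: "\<And>v. tpoly_eval f v =
      cubic_form c300 c030 c003 c210 c201 c120 c021 c102 c012 c111 v"
  shows partial_1_of_explicit_cubic: "tpoly_eval (partial 1 f) v =
      3 * c300 * (v$1)^2 + 2 * c210 * v$1 * v$2 + 2 * c201 * v$1 * v$3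
      + c120 * (v$2)^2 + c102 * (v$3)^2 + c111 * v$2 * v$3" (is "_ = ?p1 v")
    and partial_2_of_explicit_cubic: "tpoly_eval (partial 2 f) v =
      3 * c030 * (v$2)^2 + c210 * (v$1)^2 + 2 * c120 * v$1 * v$2 + 2 * c021 * v$2 * v$3
      + c012 * (v$3)^2 + c111 * v$1 * v$3" (is "_ = ?p2 v")
    and partial_3_of_explicit_cubic: "tpoly_eval (partial 3 f) v =
      3 * c003 * (v$3)^2 + c201 * (v$1)^2 + c021 * (v$2)^2 + 2 * c102 * v$1 * v$3
      + 2 * c012 * v$2 * v$3 + c111 * v$1 * v$2" (is "_ = ?p3 v")
    and Hess_of_explicit_cubic: "tpoly_eval (Hess f) v =
      (let xx = 6 * c300 * v$1 + 2 * c210 * v$2 + 2 * c201 * v$3;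
           yy = 6 * c030 * v$2 + 2 * c120 * v$1 + 2 * c021 * v$3;
           zz = 6 * c003 * v$3 + 2 * c102 * v$1 + 2 * c012 * v$2;
           xy = 2 * c210 * v$1 + 2 * c120 * v$2 + c111 * v$3;
           xz = 2 * c201 * v$1 + 2 * c102 * v$3 + c111 * v$2;
           yz = 2 * c021 * v$2 + 2 * c012 * v$3 + c111 * v$1
       in xx * yy * zz + 2 * xy * yz * xz - xx * yz^2 - yy * xz^2 - zz * xy^2)"
proof -
  have p1: "tpoly_eval (partial 1 f) v = ?p1 v" for v
    by (rule tpoly_eval_partial_eqI)
      (unfold f axis_shift, auto intro!: derivative_eq_intros)
  have p2: "tpoly_eval (partial 2 f) v = ?p2 v" for v
    by (rule tpoly_eval_partial_eqI)
      (unfold f axis_shift, auto intro!: derivative_eq_intros)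
  have p3: "tpoly_eval (partial 3 f) v = ?p3 v" for v
    by (rule tpoly_eval_partial_eqI)
      (unfold f axis_shift, auto intro!: derivative_eq_intros)
  show "tpoly_eval (partial 1 f) v = ?p1 v" "tpoly_eval (partial 2 f) v = ?p2 v"
    "tpoly_eval (partial 3 f) v = ?p3 v"
    by (fact p1 p2 p3)+
  have 11: "tpoly_eval (partial 1 (partial 1 f)) v = 6 * c300 * v$1 + 2 * c210 * v$2 + 2 * c201 * v$3"
    by (rule tpoly_eval_partial_eqI)
      (unfold p1 axis_shift, auto intro!: derivative_eq_intros)
  have 21: "tpoly_eval (partial 2 (partial 1 f)) v = 2 * c210 * v$1 + 2 * c120 * v$2 + c111 * v$3"
    by (rule tpoly_eval_partial_eqI)
      (unfold p1 axis_shift, auto intro!: derivative_eq_intros)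
  have 31: "tpoly_eval (partial 3 (partial 1 f)) v = 2 * c201 * v$1 + 2 * c102 * v$3 + c111 * v$2"
    by (rule tpoly_eval_partial_eqI)
      (unfold p1 axis_shift, auto intro!: derivative_eq_intros)
  have 12: "tpoly_eval (partial 1 (partial 2 f)) v = 2 * c210 * v$1 + 2 * c120 * v$2 + c111 * v$3"
    by (rule tpoly_eval_partial_eqI)
      (unfold p2 axis_shift, auto intro!: derivative_eq_intros)
  have 22: "tpoly_eval (partial 2 (partial 2 f)) v = 6 * c030 * v$2 + 2 * c120 * v$1 + 2 * c021 * v$3"
    by (rule tpoly_eval_partial_eqI)
      (unfold p2 axis_shift, auto intro!: derivative_eq_intros)
  have 32: "tpoly_eval (partial 3 (partial 2 f)) v = 2 * c021 * v$2 + 2 * c012 * v$3 + c111 * v$1"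
    by (rule tpoly_eval_partial_eqI)
      (unfold p2 axis_shift, auto intro!: derivative_eq_intros)
  have 13: "tpoly_eval (partial 1 (partial 3 f)) v = 2 * c201 * v$1 + 2 * c102 * v$3 + c111 * v$2"
    by (rule tpoly_eval_partial_eqI)
      (unfold p3 axis_shift, auto intro!: derivative_eq_intros)
  have 23: "tpoly_eval (partial 2 (partial 3 f)) v = 2 * c021 * v$2 + 2 * c012 * v$3 + c111 * v$1"
    by (rule tpoly_eval_partial_eqI)
      (unfold p3 axis_shift, auto intro!: derivative_eq_intros)
  have 33: "tpoly_eval (partial 3 (partial 3 f)) v = 6 * c003 * v$3 + 2 * c102 * v$1 + 2 * c012 * v$2"
    by (rule tpoly_eval_partial_eqI)
      (unfold p3 axis_shift, auto intro!: derivative_eq_intros)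
  have det_sym: "X * Y * Z + b * c * a + a * b * c - X * c * c - b * b * Z - a * Y * a
       = X * Y * Z + 2 * b * c * a - X * c^2 - Y * a^2 - Z * b^2" for X Y Z a b c :: complex
    by (simp add: power2_eq_square)
  show "tpoly_eval (Hess f) v =
      (let xx = 6 * c300 * v$1 + 2 * c210 * v$2 + 2 * c201 * v$3;
           yy = 6 * c030 * v$2 + 2 * c120 * v$1 + 2 * c021 * v$3;
           zz = 6 * c003 * v$3 + 2 * c102 * v$1 + 2 * c012 * v$2;
           xy = 2 * c210 * v$1 + 2 * c120 * v$2 + c111 * v$3;
           xz = 2 * c201 * v$1 + 2 * c102 * v$3 + c111 * v$2;
           yz = 2 * c021 * v$2 + 2 * c012 * v$3 + c111 * v$1
       in xx * yy * zz + 2 * xy * yz * xz - xx * yz^2 - yy * xz^2 - zz * xy^2)"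
    unfolding tpoly_eval_Hess det_3 vec_lambda_beta 11 12 13 21 22 23 31 32 33 Let_def
    by (rule det_sym)
qed

lemma cubic_coefficients:
  assumes "homogeneous 3 f"
  obtains c300 c030 c003 c210 c201 c120 c021 c102 c012 c111 where
    "\<And>v. tpoly_eval f v =
      cubic_form c300 c030 c003 c210 c201 c120 c021 c102 c012 c111 v"
proof -
  define form where "form a v =
      a 3 0 * (v$1)^3 + a 0 3 * (v$2)^3 + a 0 0 * (v$3)^3
      + a 2 1 * (v$1)^2 * v$2 + a 2 0 * (v$1)^2 * v$3 + a 1 2 * v$1 * (v$2)^2
      + a 0 2 * (v$2)^2 * v$3 + a 1 0 * v$1 * (v$3)^2 + a 0 1 * v$2 * (v$3)^2
      + a 1 1 * v$1 * v$2 * v$3" for a :: "nat \<Rightarrow> nat \<Rightarrow> complex" and v :: "complex ^ 3"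
  \<comment> \<open>The monomials of \<open>f\<close> are added one by one; the ten cases are the exponents with sum 3.\<close>
  have add_monomial: "\<exists>a'. \<forall>v. form a' v = c * mono_val m v + form a v" if "mono_deg m = 3" for a c m
  proof
    let ?i = "Poly_Mapping.lookup m 1" and ?j = "Poly_Mapping.lookup m 2"
      and ?k = "Poly_Mapping.lookup m 3"
    have sum: "?i + ?j + ?k = 3"
      using that by (simp add: sum_3)
    then have i: "?i = 0 \<or> ?i = 1 \<or> ?i = 2 \<or> ?i = 3" and j: "?j = 0 \<or> ?j = 1 \<or> ?j = 2 \<or> ?j = 3"
      by arith+
    have k: "?k = 3 - ?i - ?j" using sum by arith
    show "\<forall>v. form (\<lambda>p q. a p q + (if p = ?i \<and> q = ?j then c else 0)) v = c * mono_val m v + form a v"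
      using i j sum unfolding mono_val_3 form_def k
      by (elim disjE) (simp_all add: algebra_simps)
  qed
  have "\<exists>a. \<forall>v. (\<Sum>m\<in>K. Poly_Mapping.lookup f m * mono_val m v) = form a v"
    if "finite K" "K \<subseteq> Poly_Mapping.keys f" for K
    using that
  proof (induction K rule: finite_induct)
    case empty
    have "form (\<lambda>_ _. 0) v = 0" for v by (simp add: form_def)
    then show ?case by (intro exI[of _ "\<lambda>_ _. 0"]) simp
  next
    case (insert m K)
    then obtain a where a: "\<forall>v. (\<Sum>m\<in>K. Poly_Mapping.lookup f m * mono_val m v) = form a v"
      by auto
    have "mono_deg m = 3"
      using insert.prems assms by (simp add: homogeneous_def)
    then obtain a' where "\<forall>v. form a' v = Poly_Mapping.lookup f m * mono_val m v + form a v"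
      using add_monomial by blast
    with a insert.hyps show ?case
      by (intro exI[of _ a']) simp
  qed
  from this[of "Poly_Mapping.keys f"] obtain a where "\<forall>v. tpoly_eval f v = form a v"
    by (auto simp: tpoly_eval_def)
  then show ?thesis
    by (intro that) (auto simp: form_def)
qed

section \<open>Projective equivalence\<close>

lemma projectively_equivalentI:
  fixes A :: "complex ^ 3 ^ 3"
  assumes "det A \<noteq> 0" "c \<noteq> 0" "\<And>v. tpoly_eval g v = c * tpoly_eval f (A *v v)"
  shows "projectively_equivalent f g"
  using assms unfolding projectively_equivalent_def invertible_det_nz by blast

lemma projectively_equivalentE:
  assumes "projectively_equivalent f g"
  obtains A :: "complex ^ 3 ^ 3" and c where
    "det A \<noteq> 0" "c \<noteq> 0" "\<And>v. tpoly_eval g v = c * tpoly_eval f (A *v v)"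
  using assms unfolding projectively_equivalent_def invertible_det_nz by blast

lemma matrix_vector_mult_surj:
  assumes "det (A :: complex ^ 3 ^ 3) \<noteq> 0"
  obtains B where "det B \<noteq> 0" "\<And>v. A *v (B *v v) = v" "\<And>v. B *v (A *v v) = v"
proof -
  obtain B where B: "A ** B = mat 1" "B ** A = mat 1"
    using assms unfolding invertible_det_nz[symmetric] invertible_def by blast
  then have "invertible B" unfolding invertible_def by blast
  then show ?thesis
    using that[of B] B by (simp add: matrix_vector_mul_assoc invertible_det_nz)
qed

lemma projectively_equivalent_sym:
  assumes "projectively_equivalent f g"
  shows "projectively_equivalent g f"
proof -
  obtain A c where A: "det A \<noteq> 0" "c \<noteq> 0" "\<And>v. tpoly_eval g v = c * tpoly_eval f (A *v v)"
    using projectively_equivalentE[OF assms] by metis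
  obtain B where B: "det B \<noteq> 0" "\<And>v. A *v (B *v v) = v"
    using matrix_vector_mult_surj[OF A(1)] by metis
  show ?thesis
    by (rule projectively_equivalentI[of B "1 / c"]) (use A B in auto)
qed

lemma projectively_equivalent_trans:
  assumes "projectively_equivalent f g" "projectively_equivalent g h"
  shows "projectively_equivalent f h"
proof -
  obtain A c where A: "det A \<noteq> 0" "c \<noteq> 0" "\<And>v. tpoly_eval g v = c * tpoly_eval f (A *v v)"
    using projectively_equivalentE[OF assms(1)] by metis
  obtain B d where B: "det B \<noteq> 0" "d \<noteq> 0" "\<And>v. tpoly_eval h v = d * tpoly_eval g (B *v v)"
    using projectively_equivalentE[OF assms(2)] by metis
  show ?thesis
    by (rule projectively_equivalentI[of "A ** B" "d * c"])
      (use A B in \<open>auto simp: det_mul matrix_vector_mul_assoc\<close>)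
qed

lemma projectively_equivalent_Hess:
  assumes "projectively_equivalent f g"
  shows "projectively_equivalent (Hess f) (Hess g)"
proof -
  obtain A c where A: "det A \<noteq> 0" "c \<noteq> 0" "\<And>v. tpoly_eval g v = c * tpoly_eval f (A *v v)"
    using projectively_equivalentE[OF assms(1)] by metis
  show ?thesis
    by (rule projectively_equivalentI[of A "c ^ 3 * det A ^ 2"]) (use A Hess_covariant in auto)
qed

text \<open>
  By the chain rule the invertible matrix of the equivalence maps singular points to singular points.
\<close>

lemma smooth_cubic_equivalent:
  assumes "projectively_equivalent f g" "smooth_cubic g" "homogeneous 3 f"
  shows "smooth_cubic f"
  unfolding smooth_cubic_def
proof (intro conjI notI assms(3))
  obtain A c where A: "det A \<noteq> 0" "c \<noteq> 0" "\<And>v. tpoly_eval g v = c * tpoly_eval f (A *v v)"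
    using projectively_equivalentE[OF assms(1)] by metis
  obtain B where B: "\<And>v. A *v (B *v v) = v" 
    using matrix_vector_mult_surj[OF A(1)] by metis
  assume "\<exists>v. v \<noteq> 0 \<and> tpoly_eval f v = 0 \<and> (\<forall>i. tpoly_eval (partial i f) v = 0)"
  then obtain v where v: "v \<noteq> 0" "tpoly_eval f v = 0" "\<And>i. tpoly_eval (partial i f) v = 0"
    by blast
  have "B *v v \<noteq> 0"
    using v(1) B[of v] by (metis matrix_vector_mult_0_right)
  moreover have "tpoly_eval g (B *v v) = 0" "tpoly_eval (partial i g) (B *v v) = 0" for i
    using v by (simp_all add: A(3) partial_of_composition[OF A(3)] B)
  ultimately show False
    using assms(2) unfolding smooth_cubic_def by blast
qed

section \<open>Weierstrass cubics\<close>

lemma weierstrass_eval: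
  "tpoly_eval (weierstrass g2 g3) v =
     (v$2)^2 * v$3 - 4 * (v$1)^3 + g2 * v$1 * (v$3)^2 + g3 * (v$3)^3"
  by (simp add: weierstrass_def)

lemma weierstrass_partials:
  "tpoly_eval (partial 1 (weierstrass g2 g3)) v = g2 * (v$3)^2 - 12 * (v$1)^2"
  "tpoly_eval (partial 2 (weierstrass g2 g3)) v = 2 * v$2 * v$3"
  "tpoly_eval (partial 3 (weierstrass g2 g3)) v = (v$2)^2 + 2 * g2 * v$1 * v$3 + 3 * g3 * (v$3)^2"
  using explicit_cubic(1,2,3)[of "weierstrass g2 g3" "-4" 0 g3 0 0 0 1 g2 0 0 v]
  by (simp_all add: weierstrass_eval)

lemma weierstrass_Hess_eval:
  "tpoly_eval (Hess (weierstrass g2 g3)) v =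
     96 * v$1 * (v$2)^2 - 96 * g2 * (v$1)^2 * v$3 - 288 * g3 * v$1 * (v$3)^2 - 8 * g2^2 * (v$3)^3"
  using explicit_cubic(4)[of "weierstrass g2 g3" "-4" 0 g3 0 0 0 1 g2 0 0 v]
  by (simp add: weierstrass_eval Let_def power2_eq_square power3_eq_cube algebra_simps)

text \<open>
  The cubics through the nine flexes of a smooth cubic form the pencil that it spans with its
  hessian, and the hessian of each of them passes through these points again. The coefficients
  are found by evaluating both sides at \<open>(1, 0, 0)\<close> and \<open>(1, 1, 0)\<close>; the identity can then be
  checked by expansion. Up to numerical factors \<open>g2\<close> and \<open>g3\<close> occur here as the invariants of
  degree 4 and 6.
\<close>

lemma weierstrass_Hess_pencil:
  "tpoly_eval (Hess (Const l * weierstrass g2 g3 + Const m * Hess (weierstrass g2 g3))) v =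
     (2304 * g2 * l^2 * m - 663552 * g3 * l * m^2 + 1769472 * g2^2 * m^3)
       * tpoly_eval (weierstrass g2 g3) v
     + (l^3 - 2304 * g2 * l * m^2 + 221184 * g3 * m^3) * tpoly_eval (Hess (weierstrass g2 g3)) v"
proof -
  have "tpoly_eval (Const l * weierstrass g2 g3 + Const m * Hess (weierstrass g2 g3)) v =
    (-4 * l) * (v$1)^3 + 0 * (v$2)^3 + (g3 * l - 8 * g2^2 * m) * (v$3)^3
      + 0 * (v$1)^2 * v$2 + (-96 * g2 * m) * (v$1)^2 * v$3 + (96 * m) * v$1 * (v$2)^2
      + l * (v$2)^2 * v$3 + (g2 * l - 288 * g3 * m) * v$1 * (v$3)^2 + 0 * v$2 * (v$3)^2
      + 0 * v$1 * v$2 * v$3" for v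
    by (simp add: weierstrass_eval weierstrass_Hess_eval algebra_simps)
  note Hess = explicit_cubic(4)[OF this, of v]
  show ?thesis
    unfolding Hess Let_def weierstrass_eval weierstrass_Hess_eval by algebra
qed

text \<open>
  The singular points are the points \<open>[x : 0 : 1]\<close> with a multiple root \<open>x\<close> of
  \<open>4 x\<^sup>3 - g\<^sub>2 x - g\<^sub>3\<close>.
\<close>

lemma smooth_weierstrass_iff:
  "smooth_cubic (weierstrass g2 g3) \<longleftrightarrow> g2^3 - 27 * g3^2 \<noteq> 0"
proof
  assume smooth: "smooth_cubic (weierstrass g2 g3)"
  show "g2^3 - 27 * g3^2 \<noteq> 0"
  proof
    assume disc: "g2^3 - 27 * g3^2 = 0"
    \<comment> \<open>A multiple root of \<open>4 x\<^sup>3 - g\<^sub>2 x - g\<^sub>3\<close>.\<close>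
    define x where "x = (if g2 = 0 then 0 else - 3 * g3 / (2 * g2))"
    let ?v = "vector [x, 0, 1] :: complex ^ 3"
    have x: "12 * x^2 = g2" "2 * g2 * x + 3 * g3 = 0"
      using disc by (auto simp: x_def field_simps power2_eq_square power3_eq_cube)
    have "3 * (4 * x^3) = x * (12 * x^2)"
      by (simp add: power2_eq_square power3_eq_cube)
    also have "\<dots> = g2 * x + (2 * g2 * x + 3 * g3)"
      using x by simp
    also have "\<dots> = 3 * (g2 * x + g3)"
      by (simp add: algebra_simps)
    finally have "3 * (4 * x^3) = 3 * (g2 * x + g3)" .
    then have "4 * x^3 = g2 * x + g3"
      by (subst (asm) mult_cancel_left) simp
    then have "tpoly_eval (weierstrass g2 g3) ?v = 0"
      by (simp add: weierstrass_eval)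
    moreover have "\<forall>i. tpoly_eval (partial i (weierstrass g2 g3)) ?v = 0"
      using x by (simp add: forall_3 weierstrass_partials)
    moreover have "?v \<noteq> 0" by (simp add: vec_eq_iff forall_3)
    ultimately show False using smooth unfolding smooth_cubic_def by blast
  qed
next
  assume disc: "g2^3 - 27 * g3^2 \<noteq> 0"
  show "smooth_cubic (weierstrass g2 g3)"
    unfolding smooth_cubic_def
  proof (intro conjI homogeneous_weierstrass notI)
    assume "\<exists>v. v \<noteq> 0 \<and> tpoly_eval (weierstrass g2 g3) v = 0
      \<and> (\<forall>i. tpoly_eval (partial i (weierstrass g2 g3)) v = 0)"
    then obtain v :: "complex ^ 3" where v: "v \<noteq> 0" "g2 * (v$3)^2 = 12 * (v$1)^2" "v$2 * v$3 = 0"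
       "(v$2)^2 + 2 * g2 * v$1 * v$3 + 3 * g3 * (v$3)^2 = 0"
      by (auto simp: forall_3 weierstrass_partials)
    show False
    proof (cases "v$3 = 0")
      case True
      with v show False by (auto simp: vec_eq_iff forall_3)
    next
      case False
      with v have y: "v$2 = 0" by simp
      with v(4) have "v$3 * (2 * g2 * v$1 + 3 * g3 * v$3) = 0" by algebra
      with False have "2 * g2 * v$1 + 3 * g3 * v$3 = 0" by simp
      with v(2) have "(g2^3 - 27 * g3^2) * (v$3)^2 = 0" by algebra
      with False disc show False by simp
    qed
  qed
qed

text \<open>
  An equivalence \<open>g(v) = c f(A v)\<close> maps the pencil of \<open>f\<close> to that of \<open>g\<close>. Comparing the coefficient
  of \<open>f\<close> in the hessian of a general member gives the result with \<open>k = c det A\<close>.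
\<close>

lemma equivalent_weierstrass_scaling:
  assumes "projectively_equivalent (weierstrass g2 g3) (weierstrass h2 h3)"
  obtains k where "k \<noteq> 0" "h2 = k^4 * g2" "h3 = k^6 * g3"
proof -
  let ?f = "weierstrass g2 g3" and ?g = "weierstrass h2 h3"
  obtain A c where A: "det A \<noteq> 0" "c \<noteq> 0" "\<And>v. tpoly_eval ?g v = c * tpoly_eval ?f (A *v v)"
    using projectively_equivalentE[OF assms] by metis
  define d where "d = det A"
  have H: "tpoly_eval (Hess ?g) v = c^3 * d^2 * tpoly_eval (Hess ?f) (A *v v)" for v
    unfolding d_def by (rule Hess_covariant[OF A(3)])
  obtain B where B: "\<And>v. A *v (B *v v) = v"
    using matrix_vector_mult_surj[OF A(1)] by metis
  \<comment> \<open>The coefficient of the cubic itself in the hessian of a member of its pencil.\<close>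
  define P where "P g2 g3 l m = 2304 * g2 * l^2 * m - 663552 * g3 * l * m^2 + 1769472 * g2^2 * m^3"
    for g2 g3 l m :: complex
  have P: "P h2 h3 l m * c = d^2 * P g2 g3 (l * c) (m * (c^3 * d^2))" for l m
  proof -
    \<comment> \<open>At this point \<open>f\<close> takes the value -4 and \<open>Hess f\<close> vanishes, which isolates the coefficient \<open>P\<close>.\<close>
    let ?e = "axis 1 1 :: complex ^ 3"
    have "tpoly_eval (Const l * ?g + Const m * Hess ?g) v
      = 1 * tpoly_eval (Const (l * c) * ?f + Const (m * (c^3 * d^2)) * Hess ?f) (A *v v)" for v
      by (simp add: A(3) H algebra_simps)
    from Hess_covariant[OF this, of "B *v ?e"]
    have "tpoly_eval (Hess (Const l * ?g + Const m * Hess ?g)) (B *v ?e) = d^2 *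
       tpoly_eval (Hess (Const (l * c) * ?f + Const (m * (c^3 * d^2)) * Hess ?f)) ?e"
      by (simp add: B d_def)
    moreover have "tpoly_eval ?f ?e = -4" "tpoly_eval (Hess ?f) ?e = 0"
      by (simp_all add: weierstrass_eval weierstrass_Hess_eval axis_def)
    ultimately have "P h2 h3 l m * (c * (-4)) = d^2 * (P g2 g3 (l * c) (m * (c^3 * d^2)) * (-4))"
      unfolding weierstrass_Hess_pencil[folded P_def] A(3) H B by simp
    then show ?thesis by simp
  qed
  define e where "e = c^3 * d^2"
  \<comment> \<open>The values at three members of the pencil separate the three monomials in \<open>l\<close> and \<open>m\<close>.\<close>
  have P1: "(2304 * h2 - 663552 * h3 + 1769472 * h2^2) * c =
      d^2 * (2304 * g2 * c^2 * e - 663552 * g3 * c * e^2 + 1769472 * g2^2 * e^3)"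
    and P2: "(2304 * h2 + 663552 * h3 + 1769472 * h2^2) * c =
      d^2 * (2304 * g2 * c^2 * e + 663552 * g3 * c * e^2 + 1769472 * g2^2 * e^3)"
    and P3: "(9216 * h2 - 1327104 * h3 + 1769472 * h2^2) * c =
      d^2 * (9216 * g2 * c^2 * e - 1327104 * g3 * c * e^2 + 1769472 * g2^2 * e^3)"
    using P[of 1 1] P[of "-1" 1] P[of 2 1] unfolding P_def e_def[symmetric]
    by (simp_all add: algebra_simps)
  have "1327104 * (c * (h3 - d^2 * g3 * e^2)) = 0"
    using P1 P2 by algebra
  moreover have "6912 * (c * h2 - d^2 * g2 * c^2 * e) + 663552 * (c * h3 - d^2 * g3 * c * e^2) * -1 = 0"
    using P1 P3 by algebra
  ultimately have "c * (h3 - d^2 * g3 * e^2) = 0" "c * (h2 - d^2 * g2 * c * e) = 0"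
    by (auto simp: algebra_simps power2_eq_square)
  then have "h2 = (c * d)^4 * g2" "h3 = (c * d)^6 * g3"
    using A(2) unfolding e_def by (auto simp: power_mult_distrib eval_nat_numeral)
  with A show ?thesis
    by (intro that[of "c * d"]) (auto simp: d_def)
qed

section \<open>Existence of flexes\<close>

text \<open>
  The resultant of \<open>Z\<^sup>3 + a Z\<^sup>2 + b Z + c\<close> and \<open>p Z\<^sup>2 + q Z + r\<close>, expanded. It is stated over an
  arbitrary ring because the coefficients are to be complex numbers as well as polynomials.
\<close>

definition cubic_quadratic_resultant ::
    "'a \<Rightarrow> 'a \<Rightarrow> 'a \<Rightarrow> 'a \<Rightarrow> 'a \<Rightarrow> 'a \<Rightarrow> 'a :: comm_ring_1" where
  "cubic_quadratic_resultant a b c p q r =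
     p^3 * c^2 - p^2 * q * b * c + p^2 * r * (b^2 - 2 * a * c) + p * q^2 * a * c
     + p * q * r * (3 * c - a * b) + p * r^2 * (a^2 - 2 * b) - q^3 * c + q^2 * r * b - q * r^2 * a + r^3"

text \<open>
  This is the norm of the quadratic polynomial with respect to the roots of the cubic one; the
  coefficients of the latter are, up to sign, the elementary symmetric functions of its roots.
\<close>

lemma cubic_quadratic_resultant_product:
  fixes s t u p q r :: complex
  shows "cubic_quadratic_resultant (- (s + t + u)) (s * t + s * u + t * u) (- (s * t * u)) p q r
     = (p * s^2 + q * s + r) * (p * t^2 + q * t + r) * (p * u^2 + q * u + r)"
  unfolding cubic_quadratic_resultant_def by algebra

lemma cubic_quadratic_resultant_homogeneous:
  fixes a b c p q r k :: complex
  shows "cubic_quadratic_resultant (k * a) (k^2 * b) (k^3 * c) (k * p) (k^2 * q) (k^3 * r)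
     = k^9 * cubic_quadratic_resultant a b c p q r"
  unfolding cubic_quadratic_resultant_def by algebra

lemma cubic_quadratic_resultant_cong:
  "a = a' \<Longrightarrow> b = b' \<Longrightarrow> c = c' \<Longrightarrow> p = p' \<Longrightarrow> q = q' \<Longrightarrow> r = r' \<Longrightarrow>
     cubic_quadratic_resultant a b c p q r = cubic_quadratic_resultant a' b' c' p' q' r'"
  by simp

lemma poly_cubic_quadratic_resultant:
  "poly (cubic_quadratic_resultant a b c p q r) x =
     cubic_quadratic_resultant (poly a x) (poly b x) (poly c x) (poly p x) (poly q x) (poly r x)"
  by (simp add: cubic_quadratic_resultant_def)

lemma monic_cubic_splits:
  fixes a b c :: complex
  obtains s t u where "a = - (s + t + u)" "b = s * t + s * u + t * u" "c = - (s * t * u)"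
proof -
  have "\<exists>s. poly [:c, b, a, 1:] s = 0"
    by (rule fundamental_theorem_of_algebra) (simp add: constant_degree)
  then obtain s where s: "c + s * (b + s * (a + s)) = 0" by auto
  have "\<exists>t. poly [:b + s * (a + s), a + s, 1:] t = 0"
    by (rule fundamental_theorem_of_algebra) (simp add: constant_degree)
  then obtain t where t: "b + s * (a + s) + t * (a + s + t) = 0" by auto
  define u where "u = - (a + s + t)"
  have a: "a = - (s + t + u)" by (simp add: u_def)
  have b: "b = s * t + s * u + t * u" using t unfolding a by algebra
  have "c = - (s * t * u)" using s unfolding a b by algebra
  with a b show ?thesis by (rule that)
qed

lemma common_root_if_resultant_zero:
  fixes a b c p q r :: complex
  assumes "cubic_quadratic_resultant a b c p q r = 0"
  obtains z where "z^3 + a * z^2 + b * z + c = 0" "p * z^2 + q * z + r = 0"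
proof -
  obtain s t u where stu: "a = - (s + t + u)" "b = s * t + s * u + t * u" "c = - (s * t * u)"
    by (rule monic_cubic_splits)
  have "\<exists>z\<in>{s, t, u}. p * z^2 + q * z + r = 0"
    using assms unfolding stu cubic_quadratic_resultant_product by auto
  then obtain z where z: "z \<in> {s, t, u}" "p * z^2 + q * z + r = 0" by blast
  have "z^3 + a * z^2 + b * z + c = (z - s) * (z - t) * (z - u)"
    unfolding stu by algebra
  with z show ?thesis
    by (intro that[of z]) auto
qed

text \<open>
  The resultant with respect to \<open>y\<close> is a form \<open>R\<close> of degree 9 in \<open>x\<close> and \<open>z\<close>. Either \<open>R(x, 1)\<close> has
  a root, or it is a constant \<open>k\<close>. In the latter case \<open>R(x, z) = k z\<^sup>9\<close>, so \<open>R(1, 0) = 0\<close>. In both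
  cases there is a nontrivial zero of \<open>R\<close>, hence a common root \<open>y\<close> there.
\<close>

lemma binary_forms_common_zero:
  fixes a0 a1 b0 b1 b2 c0 c1 c2 c3 p0 p1 q0 q1 q2 r0 r1 r2 r3 :: complex
  obtains x y z where "x \<noteq> 0 \<or> z \<noteq> 0"
    "y^3 + (a0 * z + a1 * x) * y^2 + (b0 * z^2 + b1 * x * z + b2 * x^2) * y
       + (c0 * z^3 + c1 * x * z^2 + c2 * x^2 * z + c3 * x^3) = 0"
    "(p0 * z + p1 * x) * y^2 + (q0 * z^2 + q1 * x * z + q2 * x^2) * y
       + (r0 * z^3 + r1 * x * z^2 + r2 * x^2 * z + r3 * x^3) = 0"
proof -
  define R where "R x z = cubic_quadratic_resultant
     (a0 * z + a1 * x) (b0 * z^2 + b1 * x * z + b2 * x^2)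
     (c0 * z^3 + c1 * x * z^2 + c2 * x^2 * z + c3 * x^3)
     (p0 * z + p1 * x) (q0 * z^2 + q1 * x * z + q2 * x^2)
     (r0 * z^3 + r1 * x * z^2 + r2 * x^2 * z + r3 * x^3)" for x z
  have homogeneous: "R (k * x) (k * z) = k^9 * R x z" for k x z
    unfolding R_def cubic_quadratic_resultant_homogeneous[symmetric]
    by (rule cubic_quadratic_resultant_cong; algebra)
  define Rx where "Rx = cubic_quadratic_resultant [:a0, a1:] [:b0, b1, b2:] [:c0, c1, c2, c3:]
     [:p0, p1:] [:q0, q1, q2:] [:r0, r1, r2, r3:]"
  define Rz where "Rz = cubic_quadratic_resultant [:a1, a0:] [:b2, b1, b0:] [:c3, c2, c1, c0:]
     [:p1, p0:] [:q2, q1, q0:] [:r3, r2, r1, r0:]"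
  have Rx: "poly Rx x = R x 1" for x
    unfolding R_def Rx_def poly_cubic_quadratic_resultant
    by (rule cubic_quadratic_resultant_cong)
      (simp_all add: power2_eq_square power3_eq_cube algebra_simps)
  have Rz: "poly Rz z = R 1 z" for z
    unfolding R_def Rz_def poly_cubic_quadratic_resultant
    by (rule cubic_quadratic_resultant_cong)
      (simp_all add: power2_eq_square power3_eq_cube algebra_simps)
  have "\<exists>x z. (x \<noteq> 0 \<or> z \<noteq> 0) \<and> R x z = 0"
  proof (cases "\<exists>x. poly Rx x = 0")
    case True
    then show ?thesis unfolding Rx by (metis zero_neq_one)
  next
    case False
    then have "constant (poly Rx)"
      using fundamental_theorem_of_algebra by blast
    then obtain k where k: "R x 1 = k" for x
      unfolding constant_def Rx by metis
    have "poly (Rz - monom k 9) z = 0" if "z \<noteq> 0" for z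
      using homogeneous[of z "1 / z" 1] that by (simp add: k Rz poly_monom)
    then have "UNIV - {0} \<subseteq> {z. poly (Rz - monom k 9) z = 0}" by auto
    moreover have "infinite (UNIV - {0 :: complex})"
      by (simp add: infinite_UNIV_char_0)
    ultimately have "Rz - monom k 9 = 0"
      using poly_roots_finite finite_subset by blast
    then have "poly Rz 0 = 0" by (simp add: poly_monom)
    then show ?thesis unfolding Rz by (metis zero_neq_one)
  qed
  then obtain x z where xz: "x \<noteq> 0 \<or> z \<noteq> 0" "R x z = 0" by blast
  show ?thesis
    using common_root_if_resultant_zero[OF xz(2)[unfolded R_def]] that[OF xz(1)] by metis
qed

text \<open>
  The weak form of the theorem of Bezout. As the coefficient of \<open>y\<^sup>3\<close> in \<open>f\<close> does not vanish, a
  multiple of \<open>f\<close> can be subtracted from \<open>h\<close> to make it quadratic in \<open>y\<close>.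
\<close>

lemma cubics_common_zero:
  assumes "homogeneous 3 f" "homogeneous 3 h" "tpoly_eval f (axis 2 1) \<noteq> 0"
  obtains v where "v \<noteq> 0" "tpoly_eval f v = 0" "tpoly_eval h v = 0"
proof -
  obtain c300 c030 c003 c210 c201 c120 c021 c102 c012 c111 where f: "\<And>v. tpoly_eval f v =
      cubic_form c300 c030 c003 c210 c201 c120 c021 c102 c012 c111 v"
    by (rule cubic_coefficients[OF assms(1)]) blast
  obtain d300 d030 d003 d210 d201 d120 d021 d102 d012 d111 where h: "\<And>v. tpoly_eval h v =
      cubic_form d300 d030 d003 d210 d201 d120 d021 d102 d012 d111 v"
    by (rule cubic_coefficients[OF assms(2)]) blast
  have nz: "c030 \<noteq> 0"
    using assms(3) by (simp add: f axis_def)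
  define k where "k = d030 / c030"
  obtain x y z where xyz: "x \<noteq> 0 \<or> z \<noteq> 0"
    "y^3 + (c021 / c030 * z + c120 / c030 * x) * y^2
       + (c012 / c030 * z^2 + c111 / c030 * x * z + c210 / c030 * x^2) * y
       + (c003 / c030 * z^3 + c102 / c030 * x * z^2 + c201 / c030 * x^2 * z + c300 / c030 * x^3) = 0"
    "((d021 - k * c021) * z + (d120 - k * c120) * x) * y^2
       + ((d012 - k * c012) * z^2 + (d111 - k * c111) * x * z + (d210 - k * c210) * x^2) * y
       + ((d003 - k * c003) * z^3 + (d102 - k * c102) * x * z^2 + (d201 - k * c201) * x^2 * z
          + (d300 - k * c300) * x^3) = 0"
    by (rule binary_forms_common_zero) blast
  let ?v = "vector [x, y, z] :: complex ^ 3"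
  have "tpoly_eval f ?v = c030 * (y^3 + (c021 / c030 * z + c120 / c030 * x) * y^2
       + (c012 / c030 * z^2 + c111 / c030 * x * z + c210 / c030 * x^2) * y
       + (c003 / c030 * z^3 + c102 / c030 * x * z^2 + c201 / c030 * x^2 * z + c300 / c030 * x^3))"
    using nz by (simp add: f algebra_simps)
  then have fv: "tpoly_eval f ?v = 0" using xyz(2) by simp
  have "tpoly_eval h ?v - k * tpoly_eval f ?v = 
     ((d021 - k * c021) * z + (d120 - k * c120) * x) * y^2
       + ((d012 - k * c012) * z^2 + (d111 - k * c111) * x * z + (d210 - k * c210) * x^2) * y
       + ((d003 - k * c003) * z^3 + (d102 - k * c102) * x * z^2 + (d201 - k * c201) * x^2 * z
          + (d300 - k * c300) * x^3) + (d030 - k * c030) * y^3"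
    by (simp add: f h algebra_simps)
  also have "\<dots> = 0" using xyz(3) nz by (simp add: k_def)
  finally have "tpoly_eval h ?v = 0" using fv by simp
  moreover have "?v \<noteq> 0" using xyz(1) by (auto simp: vec_eq_iff forall_3)
  ultimately show ?thesis using fv that by blast
qed

text \<open>
  Used to move a point \<open>p\<close> to \<open>[0 : 1 : 0]\<close> and a line \<open>n\<close> through it to a line that contains
  \<open>[1 : 0 : 0]\<close> too. For the first column one takes the vector product \<open>n \<times> q\<close>, which is orthogonal
  to \<open>n\<close>. From \<open>(n \<times> q) \<times> p = q (n \<cdot> p) - n (q \<cdot> p)\<close> and \<open>n \<cdot> p = 0\<close> it follows that the columns
  \<open>n \<times> q\<close>, \<open>p\<close>, \<open>w\<close> have the determinant \<open>- (q \<cdot> p) (n \<cdot> w)\<close>, so it suffices to choose \<open>q\<close> and \<open>w\<close>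
  with nonzero products.
\<close>

lemma adapted_frame:
  fixes n p :: "complex ^ 3"
  assumes "p \<noteq> 0" "n \<noteq> 0" and orth: "n$1 * p$1 + n$2 * p$2 + n$3 * p$3 = 0"
  obtains B :: "complex ^ 3 ^ 3" where "det B \<noteq> 0" "B *v axis 2 1 = p"
    "n$1 * B$1$1 + n$2 * B$2$1 + n$3 * B$3$1 = 0"
proof -
  have nonzero: "\<exists>q1 q2 q3. q1 * v$1 + q2 * v$2 + q3 * v$3 \<noteq> 0" if "v \<noteq> 0" for v :: "complex ^ 3"
  proof -
    from that consider "v$1 \<noteq> 0" | "v$2 \<noteq> 0" | "v$3 \<noteq> 0" by (auto simp: vec_eq_iff forall_3)
    then show ?thesis
    proof cases
      case 1 show ?thesis by (rule exI[of _ 1], rule exI[of _ 0], rule exI[of _ 0]) (simp add: 1)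
    next
      case 2 show ?thesis by (rule exI[of _ 0], rule exI[of _ 1], rule exI[of _ 0]) (simp add: 2)
    next
      case 3 show ?thesis by (rule exI[of _ 0], rule exI[of _ 0], rule exI[of _ 1]) (simp add: 3)
    qed
  qed
  obtain q1 q2 q3 where q: "q1 * p$1 + q2 * p$2 + q3 * p$3 \<noteq> 0"
    using nonzero[OF assms(1)] by blast
  obtain w1 w2 w3 where w: "w1 * n$1 + w2 * n$2 + w3 * n$3 \<noteq> 0"
    using nonzero[OF assms(2)] by blast
  define B :: "complex ^ 3 ^ 3" where "B = vector
     [vector [n$2 * q3 - n$3 * q2, p$1, w1],
      vector [n$3 * q1 - n$1 * q3, p$2, w2],
      vector [n$1 * q2 - n$2 * q1, p$3, w3]]"
  have "det B = - ((q1 * p$1 + q2 * p$2 + q3 * p$3) * (w1 * n$1 + w2 * n$2 + w3 * n$3))"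
    using orth unfolding B_def det_3 vector_3 by algebra
  then have "det B \<noteq> 0" using q w by simp
  moreover have "B *v axis 2 1 = p"
    by (simp add: B_def vec_eq_iff forall_3 matrix_vector_mult_def sum_3 axis_def)
  moreover have "n$1 * B$1$1 + n$2 * B$2$1 + n$3 * B$3$1 = 0"
    by (simp add: B_def algebra_simps)
  ultimately show ?thesis by (rule that)
qed

lemma smooth_cubic_nonvanishing:
  assumes "smooth_cubic f"
  obtains w where "w \<noteq> 0" "tpoly_eval f w \<noteq> 0"
proof -
  have f3: "homogeneous 3 f" using assms by (simp add: smooth_cubic_def)
  have "\<exists>w. w \<noteq> 0 \<and> tpoly_eval f w \<noteq> 0"
  proof (rule ccontr)
    assume "\<not> ?thesis"
    moreover have "tpoly_eval f 0 = 0"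
    proof -
      obtain c300 c030 c003 c210 c201 c120 c021 c102 c012 c111 where "\<And>v. tpoly_eval f v =
      cubic_form c300 c030 c003 c210 c201 c120 c021 c102 c012 c111 v"
        by (rule cubic_coefficients[OF f3]) blast
      then show ?thesis by simp
    qed
    ultimately have f: "tpoly_eval f v = 0" for v by metis
    have "tpoly_eval (partial i f) v = 0" for i v
      by (rule tpoly_eval_partial_eqI) (simp add: f)
    moreover have "axis 1 1 \<noteq> (0 :: complex ^ 3)" by (simp add: axis_eq_0_iff)
    ultimately show False
      using assms f unfolding smooth_cubic_def by blast
  qed
  then show ?thesis using that by blast
qed

lemma flex_exists:
  assumes "smooth_cubic f"
  obtains p where "p \<noteq> 0" "tpoly_eval f p = 0" "tpoly_eval (Hess f) p = 0"
proof -
  obtain w where w: "w \<noteq> 0" "tpoly_eval f w \<noteq> 0"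
    using smooth_cubic_nonvanishing[OF assms] .
  \<comment> \<open>Any line through \<open>w\<close> will do; only the second column of the frame matters here.\<close>
  define n :: "complex ^ 3" where
    "n = (if w$1 = 0 \<and> w$2 = 0 then axis 1 1 else vector [w$2, - w$1, 0])"
  have n: "n \<noteq> 0" "n$1 * w$1 + n$2 * w$2 + n$3 * w$3 = 0"
    by (auto simp: n_def vec_eq_iff forall_3 axis_def)
  obtain A where A: "det A \<noteq> 0" "A *v axis 2 1 = w"
    using adapted_frame[OF w(1) n] by metis
  obtain g where g: "homogeneous 3 g" "\<And>v. tpoly_eval g v = tpoly_eval f (A *v v)"
    using linear_substitution assms unfolding smooth_cubic_def by metis
  have "tpoly_eval g (axis 2 1) \<noteq> 0" using w A by (simp add: g)
  then obtain v where v: "v \<noteq> 0" "tpoly_eval g v = 0" "tpoly_eval (Hess g) v = 0"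
    using cubics_common_zero[OF g(1) homogeneous_Hess[OF g(1)]] by metis
  obtain B where B: "\<And>v. B *v (A *v v) = v"
    using matrix_vector_mult_surj[OF A(1)] by metis
  have "tpoly_eval (Hess g) v = 1 ^ 3 * det A ^ 2 * tpoly_eval (Hess f) (A *v v)"
    by (rule Hess_covariant) (simp add: g)
  with v A have "tpoly_eval (Hess f) (A *v v) = 0" by simp
  moreover have "A *v v \<noteq> 0"
    using v(1) B[of v] by (metis matrix_vector_mult_0_right)
  ultimately show ?thesis using v(2) that by (simp add: g)
qed

section \<open>Weierstrass form\<close>

text \<open>
  The square in \<open>y\<close> is completed by the shift with \<open>\<kappa>\<close> and \<open>\<mu>\<close>, then the cube in \<open>x\<close> by the shift
  with \<open>\<beta>\<close>. The factors \<open>\<alpha>\<close> and \<open>\<gamma>\<close> are chosen such that \<open>e \<alpha>\<^sup>3 = - 4 \<tau> \<gamma>\<^sup>2\<close>, which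
  gives the coefficients 1 of \<open>y\<^sup>2 z\<close> and -4 of \<open>x\<^sup>3\<close> after division by \<open>s = \<tau> \<gamma>\<^sup>2\<close>; no roots
  have to be extracted for this.
\<close>

lemma weierstrass_form_of_flex_normal_form:
  fixes \<tau> e :: complex
  assumes "\<tau> \<noteq> 0" "e \<noteq> 0"
    and g: "\<And>v. tpoly_eval g v = e * (v$1)^3 + \<tau> * (v$2)^2 * v$3 + c * v$1 * v$2 * v$3
      + d * v$2 * (v$3)^2 + k * (v$1)^2 * v$3 + l * v$1 * (v$3)^2 + m * (v$3)^3"
  shows "\<exists>g2 g3. projectively_equivalent g (weierstrass g2 g3)"
proof -
  define \<kappa> where "\<kappa> = c / (2 * \<tau>)"
  define \<mu> where "\<mu> = d / (2 * \<tau>)"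
  define \<beta> where "\<beta> = - (k - \<tau> * \<kappa>^2) / (3 * e)"
  define \<alpha> where "\<alpha> = - e * \<tau>"
  define \<gamma> where "\<gamma> = e^2 * \<tau> / 2"
  define L where "L = l - 2 * \<tau> * \<kappa> * \<mu>"
  define M where "M = m - \<tau> * \<mu>^2"
  define s where "s = \<tau> * \<gamma>^2"
  define g2 where "g2 = \<alpha> * (L - 3 * e * \<beta>^2) / s"
  define g3 where "g3 = (L * \<beta> + M - 2 * e * \<beta>^3) / s"
  have coeffs: "c = 2 * \<tau> * \<kappa>" "d = 2 * \<tau> * \<mu>" "k = \<tau> * \<kappa>^2 - 3 * e * \<beta>"
     "l = L + 2 * \<tau> * \<kappa> * \<mu>" "m = M + \<tau> * \<mu>^2"
    using assms(1,2) by (simp_all add: \<kappa>_def \<mu>_def \<beta>_def L_def M_def)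
  have s: "s \<noteq> 0" using assms(1,2) by (simp add: s_def \<gamma>_def)
  have g23: "s * g2 = \<alpha> * (L - 3 * e * \<beta>^2)" "s * g3 = L * \<beta> + M - 2 * e * \<beta>^3"
    using s by (simp_all add: g2_def g3_def)
  have s4: "e * \<alpha>^3 = - 4 * s"
    by (simp add: \<alpha>_def \<gamma>_def s_def power2_eq_square power3_eq_cube)
  define A :: "complex ^ 3 ^ 3" where "A = vector
     [vector [\<alpha>, 0, \<beta>], vector [- \<kappa> * \<alpha>, \<gamma>, - (\<kappa> * \<beta> + \<mu>)], vector [0, 0, 1]]"
  have "tpoly_eval g (A *v v) = s * tpoly_eval (weierstrass g2 g3) v" for v
  proof -
    let ?x = "v$1" and ?y = "v$2" and ?z = "v$3"
    have Av: "(A *v v)$1 = \<alpha> * ?x + \<beta> * ?z" "(A *v v)$3 = ?z"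
      "(A *v v)$2 = \<gamma> * ?y - \<kappa> * (\<alpha> * ?x + \<beta> * ?z) - \<mu> * ?z"
      by (simp_all add: A_def matrix_vector_mult_def sum_3 algebra_simps)
    have "tpoly_eval g (A *v v) = e * (\<alpha> * ?x + \<beta> * ?z)^3 + \<tau> * (\<gamma> * ?y)^2 * ?z
       - 3 * e * \<beta> * (\<alpha> * ?x + \<beta> * ?z)^2 * ?z + L * (\<alpha> * ?x + \<beta> * ?z) * ?z^2 + M * ?z^3"
      unfolding g Av coeffs by algebra
    also have "\<dots> = s * ?y^2 * ?z + (e * \<alpha>^3) * ?x^3 + (\<alpha> * (L - 3 * e * \<beta>^2)) * ?x * ?z^2
        + (L * \<beta> + M - 2 * e * \<beta>^3) * ?z^3"
      unfolding s_def by algebra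
    also have "\<dots> = s * tpoly_eval (weierstrass g2 g3) v"
      unfolding weierstrass_eval g23[symmetric] s4 by algebra
    finally show ?thesis .
  qed
  moreover have "det A \<noteq> 0"
    using assms(1,2) by (simp add: A_def det_3 \<alpha>_def \<gamma>_def)
  ultimately have "projectively_equivalent g (weierstrass g2 g3)"
    using s by (intro projectively_equivalentI[of A "1 / s"]) auto
  then show ?thesis by blast
qed

text \<open>
  After moving a flex to \<open>[0 : 1 : 0]\<close> and its tangent to \<open>z = 0\<close>, the coefficient of \<open>y\<^sup>3\<close> vanishes
  because the curve passes through the point, that of \<open>x y\<^sup>2\<close> because of the tangent, and that of
  \<open>x\<^sup>2 y\<close> because of the hessian. The coefficients of \<open>y\<^sup>2 z\<close> and \<open>x\<^sup>3\<close> do not vanish because the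
  curve is smooth.
\<close>

lemma smooth_cubic_weierstrass_form:
  assumes f: "smooth_cubic f"
  obtains g2 g3 where "g2^3 - 27 * g3^2 \<noteq> 0" "projectively_equivalent f (weierstrass g2 g3)"
proof -
  obtain p where p: "p \<noteq> 0" "tpoly_eval f p = 0" "tpoly_eval (Hess f) p = 0"
    using flex_exists[OF f] .
  define n where "n = (\<chi> i. tpoly_eval (partial i f) p)"
  have f3: "homogeneous 3 f" using f by (simp add: smooth_cubic_def)
  have "n \<noteq> 0"
    using f p by (auto simp: smooth_cubic_def n_def vec_eq_iff)
  moreover have "n$1 * p$1 + n$2 * p$2 + n$3 * p$3 = 0"
  proof -
    obtain c300 c030 c003 c210 c201 c120 c021 c102 c012 c111 where c: "\<And>v. tpoly_eval f v =
      cubic_form c300 c030 c003 c210 c201 c120 c021 c102 c012 c111 v"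
      by (rule cubic_coefficients[OF f3]) blast
    \<comment> \<open>Euler's identity.\<close>
    have "n$1 * p$1 + n$2 * p$2 + n$3 * p$3 = 3 * tpoly_eval f p"
      unfolding n_def vec_lambda_beta explicit_cubic(1,2,3)[OF c] c by algebra
    then show ?thesis by (simp add: p)
  qed
  ultimately obtain B where B: "det B \<noteq> 0" "B *v axis 2 1 = p"
      "n$1 * B$1$1 + n$2 * B$2$1 + n$3 * B$3$1 = 0"
    using adapted_frame[OF p(1)] by metis
  obtain g where g: "homogeneous 3 g" "\<And>v. tpoly_eval g v = tpoly_eval f (B *v v)"
    using linear_substitution[OF f3] by metis
  have g': "tpoly_eval g v = 1 * tpoly_eval f (B *v v)" for v
    by (simp add: g)
  have fg: "projectively_equivalent f g"
    by (rule projectively_equivalentI[OF B(1) _ g']) simp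
  have smooth_g: "smooth_cubic g"
    using smooth_cubic_equivalent[OF projectively_equivalent_sym[OF fg] f g(1)] .
  obtain c300 c030 c003 c210 c201 c120 c021 c102 c012 c111 where c: "\<And>v. tpoly_eval g v =
      cubic_form c300 c030 c003 c210 c201 c120 c021 c102 c012 c111 v"
    by (rule cubic_coefficients[OF g(1)]) blast
  note derivs = explicit_cubic[OF c]
  let ?e = "axis 2 1 :: complex ^ 3"
  have e: "?e$1 = 0" "?e$2 = 1" "?e$3 = 0" by (simp_all add: axis_def)
  have c030: "c030 = 0"
    using c[of ?e] B(2) p(2) by (simp add: g e)
  have "tpoly_eval (partial 1 g) ?e = 0"
    using B(3) partial_of_composition[OF g', of 1 ?e]
    by (simp add: sum_3 n_def B(2) mult.commute)
  then have c120: "c120 = 0"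
    by (simp add: derivs(1) e)
  have c021: "c021 \<noteq> 0"
  proof
    assume "c021 = 0"
    then have "tpoly_eval g ?e = 0" "\<forall>i. tpoly_eval (partial i g) ?e = 0"
      by (simp_all add: c derivs(1,2,3) e forall_3 c030 c120)
    moreover have "?e \<noteq> 0" by (simp add: axis_eq_0_iff)
    ultimately show False using smooth_g unfolding smooth_cubic_def by blast
  qed
  have "tpoly_eval (Hess g) ?e = 0"
    using Hess_covariant[OF g', of ?e] p(3) by (simp add: B(2))
  then have c210: "c210 = 0"
    using c021 by (simp add: derivs(4) Let_def e c030 c120)
  have c300: "c300 \<noteq> 0"
  proof
    assume c300: "c300 = 0"
    have "\<exists>y. poly [:c201, c111, c021:] y = 0"
      by (rule fundamental_theorem_of_algebra) (use c021 in \<open>simp add: constant_degree\<close>)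
    \<comment> \<open>The line \<open>z = 0\<close> would be a component of the curve, and it would meet the residual
      conic in a singular point.\<close>
    then obtain y where y: "c201 + y * (c111 + y * c021) = 0" by auto
    let ?v = "vector [1, y, 0] :: complex ^ 3"
    have "tpoly_eval g ?v = 0" "\<forall>i. tpoly_eval (partial i g) ?v = 0"
      using y by (simp_all add: c derivs(1,2,3) forall_3 c030 c120 c210 c300 algebra_simps
          power2_eq_square)
    moreover have "?v \<noteq> 0" by (simp add: vec_eq_iff forall_3)
    ultimately show False using smooth_g unfolding smooth_cubic_def by blast
  qed
  have "tpoly_eval g v = c300 * (v$1)^3 + c021 * (v$2)^2 * v$3 + c111 * v$1 * v$2 * v$3
      + c012 * v$2 * (v$3)^2 + c201 * (v$1)^2 * v$3 + c102 * v$1 * (v$3)^2 + c003 * (v$3)^3" for v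
    by (simp add: c c030 c120 c210)
  then obtain g2 g3 where "projectively_equivalent g (weierstrass g2 g3)"
    using weierstrass_form_of_flex_normal_form[OF c021 c300] by blast
  then have equiv: "projectively_equivalent f (weierstrass g2 g3)"
    using projectively_equivalent_trans[OF fg] by blast
  have "smooth_cubic (weierstrass g2 g3)"
    using smooth_cubic_equivalent[OF projectively_equivalent_sym[OF equiv] f homogeneous_weierstrass] .
  then show ?thesis
    using equiv that unfolding smooth_weierstrass_iff by blast
qed

section \<open>The hessian of a Weierstrass cubic\<close>

lemma j_invariant_weierstrass:
  assumes "projectively_equivalent f (weierstrass g2 g3)" "g2^3 - 27 * g3^2 \<noteq> 0"
  shows "j_invariant f = 1728 * g2^3 / (g2^3 - 27 * g3^2)"
  unfolding j_invariant_def
proof (rule the_equality)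
  show "\<exists>h2 h3. h2^3 - 27 * h3^2 \<noteq> 0 \<and> projectively_equivalent f (weierstrass h2 h3) \<and>
      1728 * g2^3 / (g2^3 - 27 * g3^2) = 1728 * h2^3 / (h2^3 - 27 * h3^2)"
    using assms by blast
next
  fix j assume "\<exists>h2 h3. h2^3 - 27 * h3^2 \<noteq> 0 \<and> projectively_equivalent f (weierstrass h2 h3) \<and>
      j = 1728 * h2^3 / (h2^3 - 27 * h3^2)"
  then obtain h2 h3 where h: "projectively_equivalent f (weierstrass h2 h3)"
    "j = 1728 * h2^3 / (h2^3 - 27 * h3^2)" by blast
  have "projectively_equivalent (weierstrass g2 g3) (weierstrass h2 h3)"
    using projectively_equivalent_trans[OF projectively_equivalent_sym[OF assms(1)] h(1)] .
  then obtain k where k: "k \<noteq> 0" "h2 = k^4 * g2" "h3 = k^6 * g3"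
    by (rule equivalent_weierstrass_scaling)
  have "h2^3 = k^12 * g2^3" "h2^3 - 27 * h3^2 = k^12 * (g2^3 - 27 * g3^2)"
    unfolding k by algebra+
  then show "j = 1728 * g2^3 / (g2^3 - 27 * g3^2)"
    using k(1) assms(2) by (simp add: h(2))
qed

text \<open>
  Up to a factor, the hessian is \<open>x y\<^sup>2 - (g\<^sub>2\<^sup>2 z\<^sup>3 / 12 + 3 g\<^sub>3 x z\<^sup>2 + g\<^sub>2 x\<^sup>2 z)\<close>. After the exchange
  of \<open>x\<close> and \<open>z\<close> only the cube has to be completed; the matrix does both, and its scaling clears
  the denominators in \<open>g2\<close>.
\<close>

lemma weierstrass_Hess_equivalent:
  assumes "g2 \<noteq> 0"
  shows "projectively_equivalent (Hess (weierstrass g2 g3))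
    (weierstrass ((576 * g3^2 - 16 * g2^3) / 3) ((64 * g2^3 * g3 - 1536 * g3^3) / 3))"
proof -
  define A :: "complex ^ 3 ^ 3" where
    "A = vector [vector [0, 0, 4 * g2^2], vector [0, 3, 0], vector [12, 0, - 48 * g3]]"
  have det: "det A \<noteq> 0"
    using assms by (simp add: A_def det_3)
  have eval: "tpoly_eval (weierstrass ((576 * g3^2 - 16 * g2^3) / 3) ((64 * g2^3 * g3 - 1536 * g3^3) / 3)) v
     = 1 / (3456 * g2^2) * tpoly_eval (Hess (weierstrass g2 g3)) (A *v v)" for v
  proof -
    have Av: "(A *v v)$1 = 4 * g2^2 * v$3" "(A *v v)$2 = 3 * v$2" "(A *v v)$3 = 12 * v$1 - 48 * g3 * v$3"
      by (simp_all add: A_def matrix_vector_mult_def sum_3)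
    have "tpoly_eval (Hess (weierstrass g2 g3)) (A *v v) =
      3456 * g2^2 * tpoly_eval (weierstrass ((576 * g3^2 - 16 * g2^3) / 3) ((64 * g2^3 * g3 - 1536 * g3^3) / 3)) v"
      unfolding weierstrass_Hess_eval weierstrass_eval Av
      by (simp add: field_simps) algebra
    then show ?thesis using assms by simp
  qed
  show ?thesis
    by (rule projectively_equivalentI[OF det _ eval]) (use assms in simp)
qed

text \<open>
  For \<open>g2 = 0\<close> the hessian is \<open>96 x (y\<^sup>2 - 3 g3 z\<^sup>2)\<close>, and the line \<open>x = 0\<close> meets the other two
  lines in singular points.
\<close>

lemma smooth_weierstrass_Hess_g2:
  assumes "smooth_cubic (Hess (weierstrass g2 g3))"
  shows "g2 \<noteq> 0"
proof
  assume g2: "g2 = 0"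
  define v :: "complex ^ 3" where "v = vector [0, csqrt (3 * g3), 1]"
  have eval: "tpoly_eval (Hess (weierstrass 0 g3)) v =
     0 * (v$1)^3 + 0 * (v$2)^3 + 0 * (v$3)^3
      + 0 * (v$1)^2 * v$2 + 0 * (v$1)^2 * v$3 + 96 * v$1 * (v$2)^2
      + 0 * (v$2)^2 * v$3 + (- 288 * g3) * v$1 * (v$3)^2 + 0 * v$2 * (v$3)^2
      + 0 * v$1 * v$2 * v$3" for v
    by (simp add: weierstrass_Hess_eval)
  have "\<forall>i. tpoly_eval (partial i (Hess (weierstrass 0 g3))) v = 0"
    unfolding forall_3 explicit_cubic(1,2,3)[OF eval] by (simp add: v_def)
  moreover have "tpoly_eval (Hess (weierstrass 0 g3)) v = 0"
    by (simp add: eval v_def)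
  moreover have "v \<noteq> 0" by (simp add: v_def vec_eq_iff forall_3)
  ultimately show False
    using assms unfolding g2 smooth_cubic_def by blast
qed

text \<open>
  So the hessian of a smooth Weierstrass cubic is smooth if and only if \<open>g2 \<noteq> 0\<close>, that is, \<open>j \<noteq> 0\<close>.
\<close>

lemma Hess_discriminant:
  "((576 * g3^2 - 16 * g2^3) / 3)^3 - 27 * ((64 * g2^3 * g3 - 1536 * g3^3) / 3)^2
     = - (4096 / 27) * g2^6 * (g2^3 - 27 * g3^2)" for g2 g3 :: complex
proof -
  have numerator: "(576 * g3^2 - 16 * g2^3)^3 - 81 * (64 * g2^3 * g3 - 1536 * g3^3)^2
     = - 4096 * g2^6 * (g2^3 - 27 * g3^2)"
    by algebra
  have scale: "(a / 3)^3 - 27 * (b / 3)^2 = (a^3 - 81 * b^2) / 27" for a b :: complex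
    by (simp add: power_divide field_simps)
  show ?thesis unfolding scale numerator by simp
qed

lemma j_invariant_Hess:
  assumes "smooth_cubic f" "smooth_cubic (Hess f)"
  shows "j_invariant f \<noteq> 0"
    and "j_invariant (Hess f) = - ((j_invariant f - 6912)^3 / (27 * (j_invariant f)^2))"
proof -
  obtain g2 g3 where disc: "g2^3 - 27 * g3^2 \<noteq> 0" and equiv: "projectively_equivalent f (weierstrass g2 g3)"
    using smooth_cubic_weierstrass_form[OF assms(1)] .
  note equiv_Hess = projectively_equivalent_Hess[OF equiv]
  have "smooth_cubic (Hess (weierstrass g2 g3))"
    using smooth_cubic_equivalent[OF projectively_equivalent_sym[OF equiv_Hess] assms(2)
        homogeneous_Hess[OF homogeneous_weierstrass]] .
  then have g2: "g2 \<noteq> 0" by (rule smooth_weierstrass_Hess_g2)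
  let ?h2 = "(576 * g3^2 - 16 * g2^3) / 3" and ?h3 = "(64 * g2^3 * g3 - 1536 * g3^3) / 3"
  have "j_invariant (Hess f) = 1728 * ?h2^3 / (?h2^3 - 27 * ?h3^2)"
    using projectively_equivalent_trans[OF equiv_Hess weierstrass_Hess_equivalent[OF g2]]
    by (rule j_invariant_weierstrass) (use disc g2 in \<open>simp add: Hess_discriminant\<close>)
  then have jH: "j_invariant (Hess f) = 1728 * ?h2^3 / (- (4096 / 27) * g2^6 * (g2^3 - 27 * g3^2))"
    by (simp only: Hess_discriminant)
  have j: "j_invariant f = 1728 * g2^3 / (g2^3 - 27 * g3^2)"
    by (rule j_invariant_weierstrass[OF equiv disc])
  show "j_invariant f \<noteq> 0"
    using g2 disc by (simp add: j)
  define D where "D = g2^3 - 27 * g3^2"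
  have g3: "g3^2 = (g2^3 - D) / 27" by (simp add: D_def)
  have D: "D \<noteq> 0" using disc by (simp add: D_def)
  have h2: "?h2 = (16 * g2^3 - 64 * D) / 9" unfolding g3 by (simp add: field_simps)
  show "j_invariant (Hess f) = - ((j_invariant f - 6912)^3 / (27 * (j_invariant f)^2))"
    unfolding j jH h2 D_def[symmetric] using g2 D
    by (simp add: divide_simps) algebra
qed

lemma smooth_cubic_with_j_invariant:
  assumes "j \<noteq> 0"
  obtains f where "smooth_cubic f" "smooth_cubic (Hess f)" "j_invariant f = j"
proof -
  \<comment> \<open>For \<open>g2 = 3\<close> and \<open>g3 = s\<close> the j-invariant is \<open>1728 / (1 - s\<^sup>2)\<close>.\<close>
  define s where "s = csqrt (1 - 1728 / j)"
  have s: "3^3 - 27 * s^2 = 46656 / j"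
    by (simp add: s_def)
  have disc: "3^3 - 27 * s^2 \<noteq> 0"
    unfolding s using assms by simp
  let ?f = "weierstrass 3 s"
  have refl: "projectively_equivalent ?f ?f"
    by (rule projectively_equivalentI[of "mat 1" 1]) auto
  have "j_invariant ?f = j"
    unfolding j_invariant_weierstrass[OF refl disc] s using assms by simp
  moreover have "smooth_cubic ?f"
    using disc by (simp only: smooth_weierstrass_iff) simp
  moreover have "smooth_cubic (Hess ?f)"
  proof (rule smooth_cubic_equivalent[OF weierstrass_Hess_equivalent])
    show "smooth_cubic (weierstrass ((576 * s^2 - 16 * 3^3) / 3) ((64 * 3^3 * s - 1536 * s^3) / 3))"
      unfolding smooth_weierstrass_iff Hess_discriminant using disc by simp
  qed (simp_all add: homogeneous_Hess homogeneous_weierstrass)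
  ultimately show ?thesis using that by blast
qed

section \<open>Morphisms of the projective line\<close>

lemma poly_eqI_cofinite:
  fixes p q :: "complex poly"
  assumes "finite S" "\<And>z. z \<notin> S \<Longrightarrow> poly p z = poly q z"
  shows "p = q"
proof (rule ccontr)
  assume "p \<noteq> q"
  then have "finite {z. poly (p - q) z = 0}" by (intro poly_roots_finite) simp
  moreover have "UNIV \<subseteq> S \<union> {z. poly (p - q) z = 0}" using assms(2) by auto
  ultimately have "finite (UNIV :: complex set)"
    using assms(1) by (metis finite_Un finite_subset)
  then show False by (simp add: infinite_UNIV_char_0)
qed

lemma P1_map_scaled:
  assumes "c \<noteq> 0"
  shows "P1_map (smult c p) (smult c q) = P1_map p q"
  using assms by (auto simp: P1_map_def Let_def fun_eq_iff split: option.split)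

text \<open>
  The two fractions agree at infinitely many points, hence \<open>p' q = p q'\<close>. As both are in lowest
  terms, the two pairs of polynomials differ by a constant factor, so that the maps agree at
  infinity and at the exceptional points, too.
\<close>

lemma P1_map_determined:
  assumes "coprime p q" "coprime p' q'" "q \<noteq> 0" "finite S"
    and "\<And>z. z \<notin> S \<Longrightarrow> P1_map p' q' (Some z) = Some (poly p z / poly q z)"
  shows "P1_map p' q' = P1_map p q"
proof -
  have eq: "p' * q = p * q'"
  proof (rule poly_eqI_cofinite)
    show "finite (S \<union> {z. poly q z = 0})"
      using assms(3,4) by (simp add: poly_roots_finite)
    show "poly (p' * q) z = poly (p * q') z" if "z \<notin> S \<union> {z. poly q z = 0}" for z
      using assms(5)[of z] that by (auto simp: P1_map_def Let_def field_simps split: if_splits)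
  qed
  have "q dvd q'"
    using eq assms(1) by (metis coprime_commute coprime_dvd_mult_right_iff dvd_triv_right)
  moreover have "q' dvd q"
    using eq assms(2) by (metis coprime_commute coprime_dvd_mult_right_iff dvd_triv_right)
  ultimately obtain c where c: "q' = q * c" "is_unit c"
    using assms(3) by (metis dvd_def dvd_mult_cancel_left dvd_times_left_cancel_iff mult.right_neutral)
  obtain k where k: "c = [:k:]" "k \<noteq> 0"
    using c(2) by (auto simp: is_unit_poly_iff dvd_field_iff)
  have "p' * q = smult k p * q"
    using eq by (simp add: c k)
  then have "p' = smult k p"
    by (subst (asm) mult_cancel_right) (simp add: assms(3))
  then show ?thesis
    using k by (simp add: c P1_map_scaled)
qed

lemma pullback_coord_eqI:
  assumes "q \<noteq> 0" "\<And>z. poly q z \<noteq> 0 \<Longrightarrow> H (Some z) = Some (poly p z / poly q z)"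
  shows "pullback_coord H = Fract p q"
  unfolding pullback_coord_def
proof (rule the_equality)
  show "\<exists>p' q'. q' \<noteq> 0 \<and> Fract p q = Fract p' q' \<and>
      (\<forall>z. poly q' z \<noteq> 0 \<longrightarrow> H (Some z) = Some (poly p' z / poly q' z))"
    using assms by blast
next
  fix r assume "\<exists>p' q'. q' \<noteq> 0 \<and> r = Fract p' q' \<and>
      (\<forall>z. poly q' z \<noteq> 0 \<longrightarrow> H (Some z) = Some (poly p' z / poly q' z))"
  then obtain p' q' where r: "q' \<noteq> 0" "r = Fract p' q'"
    "\<And>z. poly q' z \<noteq> 0 \<Longrightarrow> H (Some z) = Some (poly p' z / poly q' z)" by blast
  have "p' * q = p * q'"
  proof (rule poly_eqI_cofinite)
    show "finite ({z. poly q z = 0} \<union> {z. poly q' z = 0})"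
      using assms(1) r(1) by (simp add: poly_roots_finite)
    show "poly (p' * q) z = poly (p * q') z" if "z \<notin> {z. poly q z = 0} \<union> {z. poly q' z = 0}" for z
      using assms(2)[of z] r(3)[of z] that by (auto simp: field_simps)
  qed
  then show "r = Fract p q"
    using assms(1) r(1) by (simp add: r(2) eq_fract)
qed

section \<open>The hessian dynamical system\<close>

lemma hessian_dynamics_eq: "hessian_dynamics = P1_map (- ([:-6912, 1:] ^ 3)) [:0, 0, 27:]"
  (is "_ = P1_map ?p ?q")
  unfolding hessian_dynamics_def
proof (rule the_equality)
  have coprime: "coprime ?p ?q"
  proof -
    have "coprime [:-6912, 1:] [:0, 0, 27 :: complex:]"
    proof (rule coprimeI)
      fix d :: "complex poly" assume d: "d dvd [:-6912, 1:]" "d dvd [:0, 0, 27:]"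
      \<comment> \<open>Division of \<open>27 X\<^sup>2\<close> by \<open>X - 6912\<close> with remainder.\<close>
      have "d dvd [:0, 0, 27:] - [:-6912, 1:] * [:27 * 6912, 27:]"
        by (intro dvd_diff dvd_mult2 d)
      then have "d dvd [:27 * 6912^2:]" by (simp add: power2_eq_square)
      moreover have "is_unit [:27 * 6912^2 :: complex:]" by (simp add: is_unit_const_poly_iff dvd_field_iff)
      ultimately show "is_unit d" by (rule dvd_unit_imp_unit)
    qed
    then show ?thesis
      by (simp only: coprime_minus_left_iff coprime_power_left_iff simp_thms)
  qed
  have map_value: "P1_map ?p ?q (Some z) = Some (- ((z - 6912)^3 / (27 * z^2)))" if "z \<noteq> 0" for z
    using that by (simp add: P1_map_def Let_def power2_eq_square mult.commute)
  show "P1_morphism (P1_map ?p ?q) \<and> (\<forall>f. smooth_cubic f \<and> smooth_cubic (Hess f) \<longrightarrow>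
      P1_map ?p ?q (Some (j_invariant f)) = Some (j_invariant (Hess f)))"
  proof (intro conjI allI impI)
    show "P1_morphism (P1_map ?p ?q)"
      using coprime unfolding P1_morphism_def by blast
    fix f assume "smooth_cubic f \<and> smooth_cubic (Hess f)"
    then have f: "smooth_cubic f" "smooth_cubic (Hess f)" by simp_all
    show "P1_map ?p ?q (Some (j_invariant f)) = Some (j_invariant (Hess f))"
      unfolding j_invariant_Hess(2)[OF f] by (rule map_value[OF j_invariant_Hess(1)[OF f]])
  qed
  fix H assume H: "P1_morphism H \<and> (\<forall>f. smooth_cubic f \<and> smooth_cubic (Hess f) \<longrightarrow>
      H (Some (j_invariant f)) = Some (j_invariant (Hess f)))"
  then obtain p q where pq: "coprime p q" "H = P1_map p q"
    unfolding P1_morphism_def by blast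
  have "P1_map p q (Some z) = Some (poly ?p z / poly ?q z)" if z: "z \<notin> {0}" for z
  proof -
    obtain f where f: "smooth_cubic f" "smooth_cubic (Hess f)" "j_invariant f = z"
      using smooth_cubic_with_j_invariant z by blast
    then have "H (Some z) = Some (- ((z - 6912)^3 / (27 * z^2)))"
      using H j_invariant_Hess(2)[OF f(1,2)] by auto
    then show ?thesis
      by (simp add: pq(2) power2_eq_square mult.commute)
  qed
  then show "H = P1_map ?p ?q"
    unfolding pq(2) by (intro P1_map_determined[OF coprime pq(1), of "{0}"]) auto
qed

lemma fract_numeral: "(numeral n :: complex poly fract) = Fract (numeral n) 1"
  by (metis Fract_of_nat_eq of_nat_numeral)

theorem theorem3p4:
  "pullback_coord hessian_dynamics =
     - (1 / 3 ^ 3) * ((j_coord - 2 ^ 8 * 3 ^ 3) ^ 3 / j_coord ^ 2)"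
proof -
  have "pullback_coord hessian_dynamics = Fract (- ([:-6912, 1:] ^ 3)) [:0, 0, 27:]"
    unfolding hessian_dynamics_eq
    by (rule pullback_coord_eqI) (auto simp: P1_map_def Let_def)
  also have "\<dots> = - (Fract [:-6912, 1:] 1 ^ 3 / (27 * j_coord ^ 2))"
    by (simp add: j_coord_def fract_numeral power2_eq_square power3_eq_cube numeral_poly)
  also have "Fract [:-6912, 1:] 1 = j_coord - 6912"
    by (simp add: j_coord_def fract_numeral numeral_poly)
  finally show ?thesis by simp
qed

end
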